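(* Let $I$ be a proper TA-ideal of an arithmetical ring $R$. Then $I$ is a prime ideal or a product of two (not necessarily distinct) prime ideals. In particular, the arithmetical TAF-rings are exactly the ZPI-rings, i.e. a ring is both arithmetical and a TAF-ring if and only if it is a ZPI-ring.
   Context: All rings are commutative with identity. An ideal $I$ of a ring $R$ is a 2-absorbing ideal (TA-ideal) if whenever $a,b,c\in R$ and $abc\in I$, then $ab\in I$ or $ac\in I$ or $bc\in I$. A TA-factorization of an ideal $I$ is an expression $I=J_1\cdots J_n$ as a product of proper TA-ideals. $R$ is a TAF-ring if every proper ideal of $R$ has a TA-factorization. A chained ring is a ring in which every two ideals are comparable under inclusion. An arithmetical ring is a ring whose localizations at maximal ideals are chained rings. A ZPI-ring is a ring whose proper ideals are (finite) products of prime ideals. *)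

theory Defs
  imports "HOL-Algebra.Ideal_Product"
begin

text \<open>Fractions over a multiplicative subset \<open>S\<close>: the pair \<open>(r, s)\<close> stands for \<open>r / s\<close>.
  The factor \<open>t\<close> is needed because \<open>R\<close> may have zero divisors.\<close>

definition frac_rel :: "('a, 'b) ring_scheme \<Rightarrow> 'a set \<Rightarrow> (('a \<times> 'a) \<times> ('a \<times> 'a)) set" where
  "frac_rel R S =
     {((r, s), (r', s')) | r s r' s'.
        r \<in> carrier R \<and> s \<in> S \<and> r' \<in> carrier R \<and> s' \<in> S \<and>
        (\<exists>t\<in>S. t \<otimes>\<^bsub>R\<^esub> ((s' \<otimes>\<^bsub>R\<^esub> r) \<ominus>\<^bsub>R\<^esub> (s \<otimes>\<^bsub>R\<^esub> r')) = \<zero>\<^bsub>R\<^esub>)}"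

text \<open>The operations are defined on representatives; the unions are over sets all of whose
  members yield the same class, as in \<^theory>\<open>HOL.Equiv_Relations\<close>.\<close>

definition localization_ring :: "('a, 'b) ring_scheme \<Rightarrow> 'a set \<Rightarrow> ('a \<times> 'a) set ring" where
  "localization_ring R S =
     \<lparr> carrier = (carrier R \<times> S) // frac_rel R S,
       monoid.mult = (\<lambda>A B. \<Union>(r, s)\<in>A. \<Union>(r', s')\<in>B.
                        frac_rel R S `` {(r \<otimes>\<^bsub>R\<^esub> r', s \<otimes>\<^bsub>R\<^esub> s')}),
       one = frac_rel R S `` {(\<one>\<^bsub>R\<^esub>, \<one>\<^bsub>R\<^esub>)},
       zero = frac_rel R S `` {(\<zero>\<^bsub>R\<^esub>, \<one>\<^bsub>R\<^esub>)},
       add = (\<lambda>A B. \<Union>(r, s)\<in>A. \<Union>(r', s')\<in>B.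
                frac_rel R S `` {((s' \<otimes>\<^bsub>R\<^esub> r) \<oplus>\<^bsub>R\<^esub> (s \<otimes>\<^bsub>R\<^esub> r'), s \<otimes>\<^bsub>R\<^esub> s')}) \<rparr>"

definition chained_ring :: "('a, 'b) ring_scheme \<Rightarrow> bool" where
  "chained_ring R \<longleftrightarrow> cring R \<and> (\<forall>I J. ideal I R \<longrightarrow> ideal J R \<longrightarrow> I \<subseteq> J \<or> J \<subseteq> I)"

definition arithmetical_ring :: "('a, 'b) ring_scheme \<Rightarrow> bool" where
  "arithmetical_ring R \<longleftrightarrow>
     cring R \<and> (\<forall>M. maximalideal M R \<longrightarrow> chained_ring (localization_ring R (carrier R - M)))"

text \<open>Following the source, a TA-ideal need not be proper.\<close>

definition TA_ideal :: "'a set \<Rightarrow> ('a, 'b) ring_scheme \<Rightarrow> bool" where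
  "TA_ideal I R \<longleftrightarrow> ideal I R \<and>
     (\<forall>a\<in>carrier R. \<forall>b\<in>carrier R. \<forall>c\<in>carrier R.
        a \<otimes>\<^bsub>R\<^esub> b \<otimes>\<^bsub>R\<^esub> c \<in> I \<longrightarrow>
        a \<otimes>\<^bsub>R\<^esub> b \<in> I \<or> a \<otimes>\<^bsub>R\<^esub> c \<in> I \<or> b \<otimes>\<^bsub>R\<^esub> c \<in> I)"

text \<open>The unit ideal \<open>carrier R\<close> is neutral for the product of ideals.\<close>

definition ideal_prod_list :: "('a, 'b) ring_scheme \<Rightarrow> 'a set list \<Rightarrow> 'a set" where
  "ideal_prod_list R Js = foldr (ideal_prod R) Js (carrier R)"

definition has_TA_factorization :: "'a set \<Rightarrow> ('a, 'b) ring_scheme \<Rightarrow> bool" where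
  "has_TA_factorization I R \<longleftrightarrow>
     (\<exists>Js. Js \<noteq> [] \<and> (\<forall>J\<in>set Js. TA_ideal J R \<and> J \<noteq> carrier R) \<and> I = ideal_prod_list R Js)"

definition TAF_ring :: "('a, 'b) ring_scheme \<Rightarrow> bool" where
  "TAF_ring R \<longleftrightarrow>
     cring R \<and> (\<forall>I. ideal I R \<longrightarrow> I \<noteq> carrier R \<longrightarrow> has_TA_factorization I R)"

definition ZPI_ring :: "('a, 'b) ring_scheme \<Rightarrow> bool" where
  "ZPI_ring R \<longleftrightarrow>
     cring R \<and>
     (\<forall>I. ideal I R \<longrightarrow> I \<noteq> carrier R \<longrightarrow>
        (\<exists>Ps. Ps \<noteq> [] \<and> (\<forall>P\<in>set Ps. primeideal P R) \<and> I = ideal_prod_list R Ps))"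

end

(*
  A ring is arithmetical iff for all x, y there is s with s x in (y) and (1 - s) y in (x). With
  this, a proper 2-absorbing ideal I satisfies A A <= I <= A, where A is its radical. If A is
  prime, then I is A-primary, and comparing some x in I - A A with the elements of A gives I = A
  unless I = A A. Otherwise a b lies in A for some a, b not in A; then (A : a) and (A : b) are
  comaximal primes, and 2-absorption modulo I gives I = A = (A : a) (A : b).

  Conversely, in a ZPI-ring localize at a maximal ideal M. A nonzero principal prime is maximal, so
  a prime N properly inside M has no element outside M N (such an element would generate a
  prime), that is, N = M N. By Nakayama's lemma no such N occurs in the factorization of a nonzero
  principal ideal. So all nonzero principal ideals are powers of M, and the localization is
  chained.
*)
theory Submission
  imports Defs "HOL-Algebra.Ring_Divisibility"
begin

section \<open>2-absorbing ideals of arithmetical rings\<close>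

text \<open>Zero divisors forbid cancelling, so local statements are kept as equations of R. The
  criterion with s and 1 - s says that the ideals ((y) : x) and ((x) : y) lie in no common maximal
  ideal. It replaces all localizations at once: z is in J as soon as s z and (1 - s) z are. For
  instance A A <= I holds because s x y is a multiple of y^2 and (1 - s) x y one of x^2.

  In the converse M is fixed and the elements outside M act as units. Inclusions after localization
  become inclusions into \<open>sat\<close> of an ideal of R, so factorizations in R are applied as
  they stand and need not be carried over to the localization. Nakayama's lemma takes an elementary
  form: t x = m x with t outside M and m in M gives (t - m) x = 0, where t - m is outside M, so x is
  locally zero.

  The hard point is that a nonzero principal prime is locally maximal. It takes two factorizations:
  one of (x, a), to find an element q that together with x generates a prime, and one of (x, q^2),
  to contradict its existence.\<close>

lemma (in cring) ideal_by_closure: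
  assumes "I \<subseteq> carrier R" and "\<zero> \<in> I"
    and add: "\<And>a b. a \<in> I \<Longrightarrow> b \<in> I \<Longrightarrow> a \<oplus> b \<in> I"
    and mult: "\<And>a x. a \<in> I \<Longrightarrow> x \<in> carrier R \<Longrightarrow> x \<otimes> a \<in> I"
  shows "ideal I R"
proof (rule idealI)
  show "ring R" by (rule ring_axioms)
  show "subgroup I (add_monoid R)"
  proof (rule add.subgroupI)
    show "\<ominus> a \<in> I" if "a \<in> I" for a
      using mult[of a "\<ominus> \<one>"] that assms(1) l_minus[of \<one> a] by auto
  qed (use assms in auto)
  show "x \<otimes> a \<in> I" if "a \<in> I" "x \<in> carrier R" for a x
    using mult that by blast
  show "a \<otimes> x \<in> I" if "a \<in> I" "x \<in> carrier R" for a x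
    using mult[OF that] m_comm[of a x] that assms(1) by auto
qed

text \<open>This glues the two halves of a comparison: s and 1 - s add up to 1, so it suffices to
  treat z after multiplication by each of them.\<close>

lemma (in cring) split_mem:
  assumes "ideal J R" "s \<in> carrier R" "z \<in> carrier R" "s \<otimes> z \<in> J" "(\<one> \<ominus> s) \<otimes> z \<in> J"
  shows "z \<in> J"
proof -
  have "z = s \<otimes> z \<oplus> (\<one> \<ominus> s) \<otimes> z" using assms by algebra
  then show ?thesis
    using additive_subgroup.a_closed[OF ideal.axioms(1)[OF assms(1)] assms(4,5)] by simp
qed

text \<open>The condition says that the annihilators of \<open>x\<close> modulo \<open>y\<close> and of \<open>y\<close> modulo \<open>x\<close> are
  comaximal; it is the elementwise form of being arithmetical.\<close>

locale pruefer_cring = cring +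
  assumes comparable: "\<lbrakk>x \<in> carrier R; y \<in> carrier R\<rbrakk> \<Longrightarrow>
    \<exists>s\<in>carrier R. \<exists>u\<in>carrier R. \<exists>v\<in>carrier R.
      s \<otimes> x = u \<otimes> y \<and> (\<one> \<ominus> s) \<otimes> y = v \<otimes> x"

section \<open>Proper 2-absorbing ideals and their radical\<close>

locale pruefer_TA = pruefer_cring R + ideal I R for I and R (structure) +
  assumes two_absorbing: "\<lbrakk>a \<in> carrier R; b \<in> carrier R; c \<in> carrier R; a \<otimes> b \<otimes> c \<in> I\<rbrakk> \<Longrightarrow>
      a \<otimes> b \<in> I \<or> a \<otimes> c \<in> I \<or> b \<otimes> c \<in> I"
    and one_notin: "\<one> \<notin> I"
begin

text \<open>For a 2-absorbing ideal, squares already suffice to describe the radical.\<close>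

definition rad :: "'a set" where "rad = {x \<in> carrier R. x \<otimes> x \<in> I}"

lemma rad_carr: "x \<in> rad \<Longrightarrow> x \<in> carrier R"
  by (simp add: rad_def)

lemma I_subset_rad: "I \<subseteq> rad"
  using I_l_closed Icarr by (auto simp: rad_def)

text \<open>Comparability replaces one factor of x y by a multiple of the other, and so reduces the
  mixed product to the squares of x and y. This also supplies the cross terms that make
  \<open>rad\<close> closed under addition.\<close>

lemma rad_mult:
  assumes x: "x \<in> rad" and y: "y \<in> rad"
  shows "x \<otimes> y \<in> I"
proof -
  have c: "x \<in> carrier R" "y \<in> carrier R" using x y by (auto simp: rad_def)
  obtain s u v where h: "s \<in> carrier R" "u \<in> carrier R" "v \<in> carrier R"
    "s \<otimes> x = u \<otimes> y" "(\<one> \<ominus> s) \<otimes> y = v \<otimes> x"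
    using comparable[OF c] by blast
  have "s \<otimes> (x \<otimes> y) = u \<otimes> (y \<otimes> y)"
    using c h(1-4) by (metis m_assoc)
  then have 1: "s \<otimes> (x \<otimes> y) \<in> I"
    using I_l_closed[OF _ h(2)] y by (simp add: rad_def)
  have "(\<one> \<ominus> s) \<otimes> (x \<otimes> y) = x \<otimes> ((\<one> \<ominus> s) \<otimes> y)" using c h(1) by algebra
  also have "\<dots> = x \<otimes> (v \<otimes> x)" by (simp only: h(5))
  also have "\<dots> = v \<otimes> (x \<otimes> x)" using c h(3) by algebra
  finally have 2: "(\<one> \<ominus> s) \<otimes> (x \<otimes> y) \<in> I"
    using I_l_closed[OF _ h(3)] x by (simp add: rad_def)
  show ?thesis using split_mem[OF is_ideal h(1) m_closed[OF c] 1 2] .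
qed

lemma rad_ideal: "ideal rad R"
proof (rule ideal_by_closure)
  show "a \<oplus> b \<in> rad" if a: "a \<in> rad" and b: "b \<in> rad" for a b
  proof -
    have "(a \<oplus> b) \<otimes> (a \<oplus> b) = a \<otimes> a \<oplus> a \<otimes> b \<oplus> (b \<otimes> a \<oplus> b \<otimes> b)"
      using rad_carr[OF a] rad_carr[OF b] by algebra
    then show ?thesis
      using rad_mult a b by (auto simp: rad_def intro!: a_closed)
  qed
  show "x \<otimes> a \<in> rad" if a: "a \<in> rad" and x: "x \<in> carrier R" for a x
  proof -
    have "(x \<otimes> a) \<otimes> (x \<otimes> a) = x \<otimes> x \<otimes> (a \<otimes> a)"
      using rad_carr[OF a] x by algebra
    then show ?thesis
      using a x by (auto simp: rad_def intro!: I_l_closed)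
  qed
qed (auto simp: rad_def)

lemmas rad_l = ideal.I_l_closed[OF rad_ideal]
lemmas rad_add = additive_subgroup.a_closed[OF ideal.axioms(1)[OF rad_ideal]]

lemma rad_minus: "a \<in> rad \<Longrightarrow> b \<in> rad \<Longrightarrow> a \<ominus> b \<in> rad"
  unfolding a_minus_def
  by (intro rad_add additive_subgroup.a_inv_closed[OF ideal.axioms(1)[OF rad_ideal]])

text \<open>2-absorption lowers the exponent from x^4 to x^3 or x^2, and from x^3 to x^2. So
  \<open>rad\<close>, although defined by squares only, is a radical ideal.\<close>

lemma rad_radical:
  assumes x: "x \<in> carrier R" and xx: "x \<otimes> x \<in> rad"
  shows "x \<in> rad"
proof -
  have "x \<otimes> x \<otimes> (x \<otimes> x) \<in> I" using xx by (simp add: rad_def)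
  then have "x \<otimes> x \<in> I \<or> x \<otimes> x \<otimes> x \<in> I"
    using two_absorbing[of x x "x \<otimes> x"] x by (auto simp: m_assoc)
  then show ?thesis using two_absorbing[of x x x] x by (auto simp: rad_def)
qed

text \<open>Squaring is multiplicative, so 2-absorption of \<open>I\<close> is applied to x^2, y^2
  and z^2.\<close>

lemma rad_two_absorbing:
  assumes "x \<in> carrier R" "y \<in> carrier R" "z \<in> carrier R" "x \<otimes> y \<otimes> z \<in> rad"
  shows "x \<otimes> y \<in> rad \<or> x \<otimes> z \<in> rad \<or> y \<otimes> z \<in> rad"
proof -
  have sq: "(a \<otimes> a) \<otimes> (b \<otimes> b) = (a \<otimes> b) \<otimes> (a \<otimes> b)" if "a \<in> carrier R" "b \<in> carrier R" for a b
    using that by algebra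
  have "(x \<otimes> y \<otimes> z) \<otimes> (x \<otimes> y \<otimes> z) \<in> I" using assms(4) by (simp add: rad_def)
  moreover have "(x \<otimes> y \<otimes> z) \<otimes> (x \<otimes> y \<otimes> z) = (x \<otimes> x) \<otimes> (y \<otimes> y) \<otimes> (z \<otimes> z)"
    using assms by algebra
  ultimately show ?thesis
    using two_absorbing[of "x \<otimes> x" "y \<otimes> y" "z \<otimes> z"] assms by (simp add: sq[symmetric] rad_def)
qed

text \<open>A radical 2-absorbing ideal has at most two minimal primes; evaluated on
  \<open>(e\<^sub>1 + e\<^sub>2) (e\<^sub>2 + e\<^sub>3) (e\<^sub>1 + e\<^sub>3)\<close>, 2-absorption excludes three elements that look like
  idempotents modulo \<open>rad\<close>.\<close>

lemma rad_no_three_orthogonal: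
  assumes c: "e1 \<in> carrier R" "e2 \<in> carrier R" "e3 \<in> carrier R"
    and o: "e1 \<otimes> e2 \<in> rad" "e1 \<otimes> e3 \<in> rad" "e2 \<otimes> e3 \<in> rad"
  shows "e1 \<in> rad \<or> e2 \<in> rad \<or> e3 \<in> rad"
proof -
  \<comment> \<open>Modulo \<open>rad\<close> the product of two of the sums is the square of their
    common summand. The three cases below differ only in which element is common.\<close>
  have key: "b \<in> rad" if k: "a \<in> carrier R" "b \<in> carrier R" "c \<in> carrier R"
    "a \<otimes> b \<in> rad" "a \<otimes> c \<in> rad" "b \<otimes> c \<in> rad" "(a \<oplus> b) \<otimes> (b \<oplus> c) \<in> rad" for a b c
  proof -
    have "b \<otimes> b = (a \<oplus> b) \<otimes> (b \<oplus> c) \<ominus> (a \<otimes> b \<oplus> a \<otimes> c \<oplus> b \<otimes> c)"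
      using k(1-3) by algebra
    moreover have "\<dots> \<in> rad" by (rule rad_minus[OF k(7) rad_add[OF rad_add[OF k(4,5)] k(6)]])
    ultimately show ?thesis using rad_radical[OF k(2)] by simp
  qed
  have "(e1 \<oplus> e2) \<otimes> (e2 \<oplus> e3) \<otimes> (e1 \<oplus> e3) =
    (e1 \<oplus> e2 \<oplus> e3) \<otimes> (e1 \<otimes> e2) \<oplus> (e1 \<oplus> e3) \<otimes> (e1 \<otimes> e3) \<oplus> (e1 \<oplus> e2 \<oplus> e3) \<otimes> (e2 \<otimes> e3)"
    using c by algebra
  moreover have "\<dots> \<in> rad" by (intro rad_add; rule rad_l) (auto intro: o c)
  ultimately consider "(e1 \<oplus> e2) \<otimes> (e2 \<oplus> e3) \<in> rad" | "(e1 \<oplus> e2) \<otimes> (e1 \<oplus> e3) \<in> rad"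
    | "(e2 \<oplus> e3) \<otimes> (e1 \<oplus> e3) \<in> rad"
    using rad_two_absorbing[of "e1 \<oplus> e2" "e2 \<oplus> e3" "e1 \<oplus> e3"] c by auto
  then show ?thesis
  proof cases
    case 1 then show ?thesis using key[of e1 e2 e3] c o by blast
  next
    case 2 then show ?thesis using key[of e2 e1 e3] c o by (simp add: m_comm a_comm)
  next
    case 3 then show ?thesis using key[of e2 e3 e1] c o by (simp add: m_comm a_comm)
  qed
qed

text \<open>If a x y is in \<open>rad\<close>, then a x, a y and b are pairwise orthogonal modulo
  \<open>rad\<close>. One of them is in \<open>rad\<close>, and b is not.\<close>

lemma colon_prime:
  assumes a: "a \<in> carrier R" "a \<notin> rad" and b: "b \<in> carrier R" "b \<notin> rad" and ab: "a \<otimes> b \<in> rad"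
  shows "primeideal {x \<in> carrier R. a \<otimes> x \<in> rad} R"
proof (rule primeidealI)
  show "ideal {x \<in> carrier R. a \<otimes> x \<in> rad} R"
    by (rule ideal.helper_max_prime[OF rad_ideal is_cring a(1)])
  show "cring R" by (rule is_cring)
  show "carrier R \<noteq> {x \<in> carrier R. a \<otimes> x \<in> rad}"
    using a by (metis (mono_tags, lifting) mem_Collect_eq one_closed r_one)
  fix x y assume x: "x \<in> carrier R" and y: "y \<in> carrier R"
    and "x \<otimes> y \<in> {x \<in> carrier R. a \<otimes> x \<in> rad}"
  then have axy: "a \<otimes> (x \<otimes> y) \<in> rad" by simp
  have "a \<otimes> x \<otimes> (a \<otimes> y) = a \<otimes> (a \<otimes> (x \<otimes> y))" using a x y by algebra
  moreover have "a \<otimes> x \<otimes> b = x \<otimes> (a \<otimes> b)" "a \<otimes> y \<otimes> b = y \<otimes> (a \<otimes> b)" using a b x y by algebra+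
  ultimately have "a \<otimes> x \<in> rad \<or> a \<otimes> y \<in> rad \<or> b \<in> rad"
    using rad_no_three_orthogonal[of "a \<otimes> x" "a \<otimes> y" b] a b x y ab axy rad_l by auto
  then show "x \<in> {x \<in> carrier R. a \<otimes> x \<in> rad} \<or> y \<in> {x \<in> carrier R. a \<otimes> x \<in> rad}"
    using b x y by auto
qed

text \<open>Modulo \<open>I\<close> the elements \<open>t = (1, 0)\<close> and \<open>s = (0, 1)\<close> are complementary idempotents;
  2-absorption is applied to \<open>(1, z) (1, z) (0, 1) = 0\<close>.\<close>

lemma component_mem:
  assumes c: "s \<in> carrier R" "t \<in> carrier R" and one: "s \<oplus> t = \<one>"
    and st: "s \<otimes> t \<in> I" and t_rad: "t \<notin> rad" and z: "z \<in> rad"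
  shows "s \<otimes> z \<in> I"
proof -
  note zc = rad_carr[OF z]
  define w where "w = t \<oplus> s \<otimes> z"
  have wc: "w \<in> carrier R" using c zc by (simp add: w_def)
  have "w \<otimes> w \<otimes> s = (t \<oplus> s \<otimes> z \<oplus> s \<otimes> z) \<otimes> (s \<otimes> t) \<oplus> (s \<otimes> s \<otimes> s) \<otimes> (z \<otimes> z)"
    unfolding w_def using c zc by algebra
  also have "\<dots> \<in> I"
    using c zc z by (intro a_closed I_l_closed[OF st] I_l_closed[of "z \<otimes> z"]) (auto simp: rad_def)
  finally have "w \<otimes> w \<in> I \<or> w \<otimes> s \<in> I" using two_absorbing[OF wc wc c(1)] by blast
  then show ?thesis
  proof
    assume "w \<otimes> w \<in> I"
    then have "w \<in> rad" using wc by (simp add: rad_def)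
    moreover have "t = w \<ominus> s \<otimes> z" unfolding w_def using c zc by algebra
    ultimately show ?thesis using rad_minus[OF _ rad_l[OF z c(1)]] t_rad by simp
  next
    assume ws: "w \<otimes> s \<in> I"
    have "s \<otimes> z = s \<otimes> (s \<oplus> t) \<otimes> z" using one c by simp
    also have "\<dots> = w \<otimes> s \<ominus> s \<otimes> t \<oplus> z \<otimes> (s \<otimes> t)" unfolding w_def using c zc by algebra
    also have "\<dots> \<in> I"
      unfolding a_minus_def by (intro a_closed a_inv_closed ws st I_l_closed zc)
    finally show ?thesis .
  qed
qed

section \<open>2-absorbing ideals whose radical is not prime\<close>

text \<open>Comaximality comes from comparing a and b: if s a = u b, then (s a)^2 = u s (a b) is in
  \<open>rad\<close>, hence s a is; likewise (1 - s) b. So s and 1 - s lie in P and Q. They are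
  orthogonal idempotents modulo \<open>rad\<close>; once they are lifted modulo \<open>I\<close>,
  \<open>component_mem\<close> puts both components of every element of \<open>rad\<close> into
  \<open>I\<close>.\<close>

lemma radical_not_prime:
  assumes np: "\<not> primeideal rad R"
  shows "\<exists>P Q. primeideal P R \<and> primeideal Q R \<and> I = ideal_prod R P Q"
proof -
  have "\<one> \<notin> rad" using one_notin by (simp add: rad_def)
  then obtain a b where a: "a \<in> carrier R" "a \<notin> rad" and b: "b \<in> carrier R" "b \<notin> rad"
    and ab: "a \<otimes> b \<in> rad"
    using ideal.primeidealCD[OF rad_ideal is_cring np] by blast
  define P where "P = {x \<in> carrier R. a \<otimes> x \<in> rad}"
  define Q where "Q = {x \<in> carrier R. b \<otimes> x \<in> rad}"
  have P: "primeideal P R" unfolding P_def using colon_prime a b ab by blast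
  have Q: "primeideal Q R" unfolding Q_def using colon_prime[of b a] a b ab by (simp add: m_comm)
  \<comment> \<open>An element of both colon ideals is orthogonal to a and to b modulo
    \<open>rad\<close>, and a and b are orthogonal to each other.\<close>
  have PQ: "P \<inter> Q \<subseteq> rad"
  proof
    fix z assume "z \<in> P \<inter> Q"
    then show "z \<in> rad" using rad_no_three_orthogonal[of a b z] a b ab by (auto simp: P_def Q_def)
  qed
  obtain s u v where h: "s \<in> carrier R" "u \<in> carrier R" "v \<in> carrier R"
    "s \<otimes> a = u \<otimes> b" "(\<one> \<ominus> s) \<otimes> b = v \<otimes> a"
    using comparable[OF a(1) b(1)] by blast
  define t where "t = \<one> \<ominus> s"
  have t: "t \<in> carrier R" "s \<oplus> t = \<one>" using h(1) unfolding t_def by simp_all algebra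
  have "(s \<otimes> a) \<otimes> (s \<otimes> a) = u \<otimes> s \<otimes> (a \<otimes> b)"
  proof -
    have "(s \<otimes> a) \<otimes> (s \<otimes> a) = (s \<otimes> a) \<otimes> (u \<otimes> b)" by (simp only: h(4))
    also have "\<dots> = u \<otimes> s \<otimes> (a \<otimes> b)" using h(1,2) a b by algebra
    finally show ?thesis .
  qed
  then have "a \<otimes> s \<in> rad" using rad_l ab h(1,2) a rad_radical[of "s \<otimes> a"] by (simp add: m_comm[of a s])
  then have sP: "s \<in> P" using h(1) a by (simp add: P_def)
  have tb: "t \<otimes> b = v \<otimes> a" using h(5) by (simp add: t_def)
  have "(t \<otimes> b) \<otimes> (t \<otimes> b) = v \<otimes> t \<otimes> (a \<otimes> b)"
  proof -
    have "(t \<otimes> b) \<otimes> (t \<otimes> b) = (t \<otimes> b) \<otimes> (v \<otimes> a)" by (simp only: tb)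
    also have "\<dots> = v \<otimes> t \<otimes> (a \<otimes> b)" using h(3) t(1) a b by algebra
    finally show ?thesis .
  qed
  then have "b \<otimes> t \<in> rad" using rad_l ab h(1-3) t(1) b rad_radical[of "t \<otimes> b"] by (simp add: m_comm[of b t])
  then have tQ: "t \<in> Q" using t(1) b by (simp add: Q_def)
  have st: "s \<otimes> t \<in> rad"
    using PQ sP tQ ideal.I_l_closed[OF primeideal.axioms(1)[OF Q]] ideal.I_r_closed[OF primeideal.axioms(1)[OF P]]
      h t by blast
  \<comment> \<open>The expansion of \<open>(s + t)\<^sup>3 = 1\<close> splits into \<open>s'\<close> and \<open>t'\<close>, which moves the
    orthogonality from \<open>rad\<close> into \<open>I\<close>.\<close>
  define p where "p = s \<oplus> t \<oplus> t \<oplus> t"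
  define q where "q = t \<oplus> s \<oplus> s \<oplus> s"
  have pq: "p \<in> carrier R" "q \<in> carrier R" using h(1) t(1) by (auto simp: p_def q_def)
  define s' where "s' = s \<otimes> s \<otimes> p"
  define t' where "t' = t \<otimes> t \<otimes> q"
  have c': "s' \<in> carrier R" "t' \<in> carrier R" using h(1) t(1) pq by (auto simp: s'_def t'_def)
  have "s' \<oplus> t' = (s \<oplus> t) \<otimes> (s \<oplus> t) \<otimes> (s \<oplus> t)"
    using h(1) t(1) unfolding s'_def t'_def p_def q_def by algebra
  then have one: "s' \<oplus> t' = \<one>" using t(2) by simp
  have "s' \<otimes> t' = p \<otimes> q \<otimes> ((s \<otimes> t) \<otimes> (s \<otimes> t))"
    using h(1) t(1) pq unfolding s'_def t'_def by algebra
  then have st': "s' \<otimes> t' \<in> I"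
    using I_l_closed[OF rad_mult[OF st st], of "p \<otimes> q"] pq by simp
  have rad_P: "rad \<subseteq> P" and rad_Q: "rad \<subseteq> Q" using a(1) b(1) rad_carr rad_l by (auto simp: P_def Q_def)
  have s'P: "s' \<in> P" and t'Q: "t' \<in> Q"
    using ideal.I_r_closed[OF primeideal.axioms(1)[OF P] sP, of "s \<otimes> p"]
      ideal.I_r_closed[OF primeideal.axioms(1)[OF Q] tQ, of "t \<otimes> q"] h(1) t(1) pq
    by (auto simp: s'_def t'_def m_assoc)
  \<comment> \<open>No prime contains both elements, as they add up to 1. Applied to P and Q, which
    contain \<open>rad\<close>, this keeps t' and s' out of \<open>rad\<close>, as
    \<open>component_mem\<close> requires.\<close>
  have notboth: "\<not> (s' \<in> J \<and> t' \<in> J)" if J: "primeideal J R" for J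
  proof
    assume "s' \<in> J \<and> t' \<in> J"
    then have "\<one> \<in> J"
      using additive_subgroup.a_closed[OF ideal.axioms(1)[OF primeideal.axioms(1)[OF J]]] one by metis
    then show False
      using ideal.one_imp_carrier[OF primeideal.axioms(1)[OF J]] primeideal.I_notcarr[OF J] by simp
  qed
  have not_rad: "s' \<notin> rad" "t' \<notin> rad" using notboth[OF P] notboth[OF Q] rad_P rad_Q s'P t'Q by auto
  have "rad \<subseteq> I"
  proof
    fix z assume z: "z \<in> rad"
    have "s' \<otimes> z \<in> I" using component_mem[OF c' one st' not_rad(2) z] .
    moreover have "t' \<otimes> z \<in> I"
      using component_mem[OF c'(2,1) _ _ not_rad(1) z] one st' c' by (simp add: a_comm m_comm)
    moreover have "s' \<otimes> z \<oplus> t' \<otimes> z = z"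
      using l_distr[OF c' rad_carr[OF z]] one rad_carr[OF z] by simp
    ultimately show "z \<in> I" by (metis a_closed)
  qed
  moreover have "ideal_prod R P Q = P \<inter> Q"
  proof (rule ideal_prod_eq_inter)
    show i: "ideal P R" "ideal Q R" using P Q by (auto dest: primeideal.axioms(1))
    have "\<one> \<in> P <+>\<^bsub>R\<^esub> Q" using sP tQ t(2) unfolding set_add_def' by blast
    then show "P <+>\<^bsub>R\<^esub> Q = carrier R" using ideal.one_imp_carrier[OF add_ideals[OF i]] by simp
  qed
  ultimately have "I = ideal_prod R P Q" using PQ rad_P rad_Q I_subset_rad by auto
  then show ?thesis using P Q by blast
qed

section \<open>2-absorbing ideals whose radical is prime\<close>

text \<open>Compare x with t. As x is in the prime \<open>rad\<close> and t is not, both 1 - s and u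
  are in \<open>rad\<close>. So (1 - s) x is in \<open>I\<close> by \<open>rad_mult\<close>. For s x
  = u t, 2-absorption is applied to t t u = s t x, where t t is not in \<open>I\<close>.\<close>

lemma rad_prime_imp_primary:
  assumes rad: "primeideal rad R" and t: "t \<in> carrier R" "t \<notin> rad" and x: "x \<in> rad" and tx: "t \<otimes> x \<in> I"
  shows "x \<in> I"
proof -
  note xc = rad_carr[OF x]
  note prime = primeideal.I_prime[OF rad]
  obtain s u v where h: "s \<in> carrier R" "u \<in> carrier R" "v \<in> carrier R"
    "s \<otimes> x = u \<otimes> t" "(\<one> \<ominus> s) \<otimes> t = v \<otimes> x"
    using comparable[OF xc t(1)] by blast
  have "(\<one> \<ominus> s) \<otimes> t \<in> rad" unfolding h(5) using rad_l[OF x h(3)] .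
  then have s: "\<one> \<ominus> s \<in> rad" using prime[of "\<one> \<ominus> s" t] h(1) t by simp
  have "u \<otimes> t \<in> rad" using rad_l[OF x h(1)] unfolding h(4) .
  then have u: "u \<in> rad" using prime[of u t] h(2) t by simp
  have "t \<otimes> t \<otimes> u = t \<otimes> (u \<otimes> t)" using t(1) h(2) by algebra
  also have "\<dots> = t \<otimes> (s \<otimes> x)" by (simp only: h(4))
  also have "\<dots> = s \<otimes> (t \<otimes> x)" using t(1) h(1) xc by algebra
  finally have "t \<otimes> t \<otimes> u \<in> I" using I_l_closed[OF tx h(1)] by simp
  then have "t \<otimes> u \<in> I" using two_absorbing[OF t(1) t(1) h(2)] t by (auto simp: rad_def)
  then have "s \<otimes> x \<in> I" unfolding h(4) using m_comm[OF t(1) h(2)] by simp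
  then show ?thesis using split_mem[OF is_ideal h(1) xc _ rad_mult[OF s x]] by blast
qed

text \<open>Fix x in \<open>I\<close> outside the square of \<open>rad\<close>, and compare it with
  y in \<open>rad\<close>. Either 1 - s is outside \<open>rad\<close> and carries y into (x), or (1
  - s) x is in the square. In the latter case s x = u y is outside the square, so u is outside
  \<open>rad\<close> and carries y into (x). Either way y is in \<open>I\<close>, because
  \<open>I\<close> is primary.\<close>

lemma radical_prime:
  assumes rad: "primeideal rad R"
  shows "I = rad \<or> I = ideal_prod R rad rad"
proof (cases "I \<subseteq> ideal_prod R rad rad")
  case True
  have "z \<in> I" if "z \<in> ideal_prod R rad rad" for z
    using that by (induction rule: ideal_prod.induct) (auto intro: rad_mult a_closed)
  then show ?thesis using True by blast
next
  case False
  note sq = ideal_prod_is_ideal[OF rad_ideal rad_ideal]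
  obtain x where x: "x \<in> I" "x \<notin> ideal_prod R rad rad" using False by blast
  have x_rad: "x \<in> rad" using x I_subset_rad by blast
  note xc = rad_carr[OF x_rad]
  have "y \<in> I" if y: "y \<in> rad" for y
  proof -
    note yc = rad_carr[OF y]
    obtain s u v where h: "s \<in> carrier R" "u \<in> carrier R" "v \<in> carrier R"
      "s \<otimes> x = u \<otimes> y" "(\<one> \<ominus> s) \<otimes> y = v \<otimes> x"
      using comparable[OF xc yc] by blast
    show ?thesis
    proof (cases "\<one> \<ominus> s \<in> rad")
      case False
      have "(\<one> \<ominus> s) \<otimes> y \<in> I" unfolding h(5) using I_l_closed[OF x(1) h(3)] .
      then show ?thesis using rad_prime_imp_primary[OF rad _ False y] h(1) by simp
    next
      case True
      then have "(\<one> \<ominus> s) \<otimes> x \<in> ideal_prod R rad rad" using x_rad by (rule ideal_prod.prod)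
      then have "u \<otimes> y \<notin> ideal_prod R rad rad"
        using split_mem[OF sq h(1) xc] x(2) h(4) by auto
      then have "u \<notin> rad" using ideal_prod.prod[of u rad y rad R] y by blast
      then show ?thesis
        using rad_prime_imp_primary[OF rad h(2) _ y] I_l_closed[OF x(1) h(1)] unfolding h(4) by blast
    qed
  qed
  then show ?thesis using I_subset_rad by blast
qed

lemma prime_or_product_of_two_primes:
  "primeideal I R \<or> (\<exists>P Q. primeideal P R \<and> primeideal Q R \<and> I = ideal_prod R P Q)"
  using radical_prime radical_not_prime by metis

end

section \<open>ZPI-rings locally at a prime ideal\<close>

context cring begin

section \<open>Finite products of ideals\<close>

lemma ideal_prod_list_Nil [simp]: "ideal_prod_list R [] = carrier R"
  by (simp add: ideal_prod_list_def)

lemma ideal_prod_list_Cons [simp]: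
  "ideal_prod_list R (I # Is) = ideal_prod R I (ideal_prod_list R Is)"
  by (simp add: ideal_prod_list_def)

lemma ideal_prod_list_ideal:
  "(\<And>I. I \<in> set Is \<Longrightarrow> ideal I R) \<Longrightarrow> ideal (ideal_prod_list R Is) R"
  by (induction Is) (auto intro: oneideal ideal_prod_is_ideal)

lemma ideal_prod_list_factor:
  assumes "I \<in> set Is" and "\<And>I. I \<in> set Is \<Longrightarrow> ideal I R"
  shows "\<exists>K. ideal K R \<and> ideal_prod_list R Is = ideal_prod R I K"
  using assms
proof (induction Is)
  case (Cons J Js)
  have J: "ideal J R" and Js: "ideal (ideal_prod_list R Js) R"
    using Cons.prems(2) by (auto intro: ideal_prod_list_ideal)
  show ?case
  proof (cases "I = J")
    case True
    then show ?thesis using Js by auto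
  next
    case False
    then obtain K where K: "ideal K R" "ideal_prod_list R Js = ideal_prod R I K"
      using Cons by auto
    have I: "ideal I R" using Cons.prems by blast
    have "ideal_prod R J (ideal_prod R I K) = ideal_prod R I (ideal_prod R J K)"
      using I J K(1) by (metis ideal_prod_assoc ideal_prod_commute)
    then show ?thesis using K(2) ideal_prod_is_ideal[OF J K(1)] by auto
  qed
qed simp

lemma prime_contains_factor:
  assumes "primeideal N R" and "\<And>I. I \<in> set Is \<Longrightarrow> ideal I R" and "ideal_prod_list R Is \<subseteq> N"
  shows "\<exists>I\<in>set Is. I \<subseteq> N"
  using assms(2,3)
proof (induction Is)
  case Nil
  then show ?case
    using primeideal.I_notcarr[OF assms(1)] ideal.Icarr[OF primeideal.axioms(1)[OF assms(1)]] by auto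
next
  case (Cons J Js)
  then have "J \<subseteq> N \<or> ideal_prod_list R Js \<subseteq> N"
    using primeideal_divides_ideal_prod[OF assms(1), of J "ideal_prod_list R Js"]
    by (auto intro: ideal_prod_list_ideal)
  then show ?case using Cons by auto
qed

section \<open>Two generators with coefficients in given ideals\<close>

text \<open>Variable coefficient ideals cover (x, y) itself as well as the ideals (x) + M y and M
  (x, y) that occur in Nakayama arguments.\<close>

definition gen2 :: "'a set \<Rightarrow> 'a \<Rightarrow> 'a set \<Rightarrow> 'a \<Rightarrow> 'a set" where
  "gen2 A x B y = {\<alpha> \<otimes> x \<oplus> \<beta> \<otimes> y |\<alpha> \<beta>. \<alpha> \<in> A \<and> \<beta> \<in> B}"

lemma gen2_ideal:
  assumes A: "ideal A R" and B: "ideal B R" and x: "x \<in> carrier R" and y: "y \<in> carrier R"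
  shows "ideal (gen2 A x B y) R"
proof -
  interpret A: ideal A R by fact
  interpret B: ideal B R by fact
  show ?thesis
  proof (rule ideal_by_closure)
    show "gen2 A x B y \<subseteq> carrier R" using x y by (auto simp: gen2_def)
    have "\<zero> = \<zero> \<otimes> x \<oplus> \<zero> \<otimes> y" using x y by simp
    then show "\<zero> \<in> gen2 A x B y" unfolding gen2_def using A.zero_closed B.zero_closed by blast
    show "a \<oplus> b \<in> gen2 A x B y" if ab: "a \<in> gen2 A x B y" "b \<in> gen2 A x B y" for a b
    proof -
      obtain \<alpha> \<beta> \<gamma> \<delta> where m: "\<alpha> \<in> A" "\<beta> \<in> B" "\<gamma> \<in> A" "\<delta> \<in> B"
        and eq: "a = \<alpha> \<otimes> x \<oplus> \<beta> \<otimes> y" "b = \<gamma> \<otimes> x \<oplus> \<delta> \<otimes> y"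
        using ab unfolding gen2_def by blast
      have "a \<oplus> b = (\<alpha> \<oplus> \<gamma>) \<otimes> x \<oplus> (\<beta> \<oplus> \<delta>) \<otimes> y"
        unfolding eq using A.Icarr[OF m(1)] B.Icarr[OF m(2)] A.Icarr[OF m(3)] B.Icarr[OF m(4)] x y by algebra
      then show ?thesis unfolding gen2_def using A.a_closed[OF m(1,3)] B.a_closed[OF m(2,4)] by blast
    qed
    show "c \<otimes> a \<in> gen2 A x B y" if a: "a \<in> gen2 A x B y" and c: "c \<in> carrier R" for a c
    proof -
      obtain \<alpha> \<beta> where m: "\<alpha> \<in> A" "\<beta> \<in> B" and eq: "a = \<alpha> \<otimes> x \<oplus> \<beta> \<otimes> y"
        using a unfolding gen2_def by blast
      have "c \<otimes> a = (c \<otimes> \<alpha>) \<otimes> x \<oplus> (c \<otimes> \<beta>) \<otimes> y"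
        unfolding eq using A.Icarr[OF m(1)] B.Icarr[OF m(2)] x y c by algebra
      then show ?thesis
        unfolding gen2_def using A.I_l_closed[OF m(1) c] B.I_l_closed[OF m(2) c] by blast
    qed
  qed
qed

lemma gen2_left:
  assumes "x \<in> carrier R" "y \<in> carrier R" "\<zero> \<in> B"
  shows "x \<in> gen2 (carrier R) x B y"
proof -
  have "x = \<one> \<otimes> x \<oplus> \<zero> \<otimes> y" using assms by simp
  then show ?thesis unfolding gen2_def using assms(3) by blast
qed

lemma gen2_right:
  assumes "x \<in> carrier R" "y \<in> carrier R" "\<zero> \<in> A"
  shows "y \<in> gen2 A x (carrier R) y"
proof -
  have "y = \<zero> \<otimes> x \<oplus> \<one> \<otimes> y" using assms by simp
  then show ?thesis unfolding gen2_def using assms(3) by blast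
qed

lemma gen2_subset:
  assumes "ideal I R" "x \<in> I" "y \<in> I" "A \<subseteq> carrier R" "B \<subseteq> carrier R"
  shows "gen2 A x B y \<subseteq> I"
  using assms additive_subgroup.a_closed[OF ideal.axioms(1)[OF assms(1)]] ideal.I_l_closed[OF assms(1)]
  unfolding gen2_def by blast

lemma ideal_prod_subsetI:
  assumes "ideal L R" and "\<And>i j. i \<in> I \<Longrightarrow> j \<in> J \<Longrightarrow> i \<otimes> j \<in> L"
  shows "ideal_prod R I J \<subseteq> L"
proof
  fix z assume "z \<in> ideal_prod R I J"
  then show "z \<in> L"
    by induction (auto intro: assms(2) additive_subgroup.a_closed[OF ideal.axioms(1)[OF assms(1)]])
qed

lemma PIdl_iff: "z \<in> PIdl x \<longleftrightarrow> (\<exists>c\<in>carrier R. z = c \<otimes> x)"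
  by (auto simp: cgenideal_def)

end

locale ZPI_at_prime = primeideal M R for M and R (structure) +
  assumes factorization: "\<lbrakk>ideal I R; I \<noteq> carrier R\<rbrakk> \<Longrightarrow>
    \<exists>Ps. (\<forall>P\<in>set Ps. primeideal P R) \<and> I = ideal_prod_list R Ps"
begin

text \<open>The contraction to \<open>R\<close> of the extension of \<open>J\<close> to the localization at \<open>M\<close>.\<close>

definition sat :: "'a set \<Rightarrow> 'a set" where
  "sat J = {x \<in> carrier R. \<exists>t\<in>carrier R - M. t \<otimes> x \<in> J}"

lemma satI: "\<lbrakk>x \<in> carrier R; t \<in> carrier R; t \<notin> M; t \<otimes> x \<in> J\<rbrakk> \<Longrightarrow> x \<in> sat J"
  unfolding sat_def by blast

lemma one_notin: "\<one> \<notin> M"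
  using one_imp_carrier I_notcarr by blast

lemma notin_mult: "\<lbrakk>s \<in> carrier R; t \<in> carrier R; s \<notin> M; t \<notin> M\<rbrakk> \<Longrightarrow> s \<otimes> t \<notin> M"
  using I_prime by blast

text \<open>Locally this says that a unit minus an element of the maximal ideal is a unit, the fact
  behind every Nakayama argument below.\<close>

lemma notin_minus:
  assumes "s \<in> carrier R" "s \<notin> M" "m \<in> M" shows "s \<ominus> m \<notin> M"
proof
  assume "s \<ominus> m \<in> M"
  then have "(s \<ominus> m) \<oplus> m \<in> M" using assms(3) a_closed by blast
  moreover have "(s \<ominus> m) \<oplus> m = s" using assms(1) Icarr[OF assms(3)] by algebra
  ultimately show False using assms(2) by simp
qed

lemma sat_ideal:
  assumes J: "ideal J R" shows "ideal (sat J) R"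
proof -
  interpret J: ideal J R by fact
  show ?thesis
  proof (rule ideal_by_closure)
    show "\<zero> \<in> sat J" using one_notin J.zero_closed by (intro satI[of _ \<one>]) auto
    show "a \<oplus> b \<in> sat J" if ab: "a \<in> sat J" "b \<in> sat J" for a b
    proof -
      have c: "a \<in> carrier R" "b \<in> carrier R" using ab by (auto simp: sat_def)
      obtain s t where s: "s \<in> carrier R" "s \<notin> M" "s \<otimes> a \<in> J"
        and t: "t \<in> carrier R" "t \<notin> M" "t \<otimes> b \<in> J"
        using ab unfolding sat_def by blast
      have "(s \<otimes> t) \<otimes> (a \<oplus> b) = t \<otimes> (s \<otimes> a) \<oplus> s \<otimes> (t \<otimes> b)"
        using c s(1) t(1) by algebra
      also have "\<dots> \<in> J" using J.I_l_closed[OF s(3) t(1)] J.I_l_closed[OF t(3) s(1)] by (rule J.a_closed)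
      finally show ?thesis
        using notin_mult[OF s(1) t(1) s(2) t(2)] s(1) t(1) c by (intro satI[of _ "s \<otimes> t"]) auto
    qed
    show "x \<otimes> a \<in> sat J" if a: "a \<in> sat J" and x: "x \<in> carrier R" for a x
    proof -
      have c: "a \<in> carrier R" using a by (auto simp: sat_def)
      obtain s where s: "s \<in> carrier R" "s \<notin> M" "s \<otimes> a \<in> J"
        using a unfolding sat_def by blast
      have "s \<otimes> (x \<otimes> a) = x \<otimes> (s \<otimes> a)" using c s(1) x by algebra
      also have "\<dots> \<in> J" using s(3) x by (rule J.I_l_closed)
      finally show ?thesis using s(1,2) c x by (intro satI[of _ s]) auto
    qed
  qed (auto simp: sat_def)
qed

lemma subset_sat: "ideal J R \<Longrightarrow> J \<subseteq> sat J"
  using one_notin ideal.Icarr[of J R] by (auto intro!: satI[of _ \<one>])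

section \<open>Primes inside M\<close>

text \<open>Later arguments need a single prime factor, one inside a given prime above
  \<open>I\<close>. What matters about the cofactor \<open>K\<close> is whether it is inside M or
  locally the unit ideal.\<close>

lemma factor_below:
  assumes I: "ideal I R" and N: "primeideal N R" and "I \<subseteq> N"
  shows "\<exists>P K. primeideal P R \<and> P \<subseteq> N \<and> ideal K R \<and> I = ideal_prod R P K"
proof -
  have "I \<noteq> carrier R"
    using assms(3) primeideal.I_notcarr[OF N] ideal.Icarr[OF primeideal.axioms(1)[OF N]] by blast
  then obtain Ps where Ps: "\<forall>P\<in>set Ps. primeideal P R" "I = ideal_prod_list R Ps"
    using factorization[OF I] by blast
  have i: "\<And>P. P \<in> set Ps \<Longrightarrow> ideal P R" using Ps(1) by (auto dest: primeideal.axioms(1))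
  obtain P where "P \<in> set Ps" "P \<subseteq> N"
    using prime_contains_factor[OF N i] Ps(2) assms(3) by blast
  then show ?thesis using ideal_prod_list_factor[of P Ps] i Ps by blast
qed

text \<open>Locally at \<open>M\<close>, a nonzero principal prime is maximal. If \<open>a \<in> M\<close> lay outside \<open>P\<close>, then
  modulo \<open>P\<close> the factor \<open>Q\<close> of \<open>(x, a)\<close> is invertible, hence locally \<open>Q = (x, q)\<close>. Now
  \<open>(x, q\<^sup>2)\<close> is not prime, so \<open>x \<in> QM = (x, q)M\<close>, and \<open>x \<in> xM\<close> because \<open>x\<close> is prime to \<open>q\<close>;
  Nakayama's lemma makes \<open>x\<close> zero.\<close>

lemma principal_prime_maximal:
  assumes x: "x \<in> M" and x0: "x \<notin> sat {\<zero>}" and P: "primeideal (sat (PIdl x)) R"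
  shows "M \<subseteq> sat (PIdl x)"
proof
  fix a assume a: "a \<in> M"
  define P where "P = sat (PIdl x)"
  interpret P: primeideal P R using P by (simp add: P_def)
  note xc = Icarr[OF x] and ac = Icarr[OF a]
  have PI: "z \<in> P" if "z \<in> carrier R" "t \<in> carrier R" "t \<notin> M" "c \<in> carrier R" "t \<otimes> z = c \<otimes> x" for z t c
    unfolding P_def using that by (intro satI[of z t]) (auto simp: PIdl_iff)
  have PE: "\<exists>t\<in>carrier R - M. \<exists>c\<in>carrier R. t \<otimes> z = c \<otimes> x" if "z \<in> P" for z
    using that unfolding P_def sat_def PIdl_iff by blast
  have PM: "P \<subseteq> M"
  proof
    fix z assume z: "z \<in> P"
    then obtain t c where "t \<in> carrier R" "t \<notin> M" "c \<in> carrier R" "t \<otimes> z = c \<otimes> x"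
      using PE by blast
    then show "z \<in> M" using I_prime[of t z] I_l_closed[OF x] P.Icarr[OF z] by auto
  qed
  have xP: "x \<in> P" unfolding P_def using subset_sat[OF cgenideal_ideal[OF xc]] cgenideal_self[OF xc] by blast
  have "a \<in> P"
  proof (rule ccontr)
    assume aP: "a \<notin> P"
    define I where "I = gen2 (carrier R) x (carrier R) a"
    have I: "ideal I R" unfolding I_def by (intro gen2_ideal oneideal xc ac)
    have aI: "a \<in> I" and xI: "x \<in> I" unfolding I_def using xc ac by (auto intro: gen2_left gen2_right)
    have "I \<subseteq> M" unfolding I_def by (intro gen2_subset is_ideal x a) auto
    then obtain Q K where Q: "primeideal Q R" "Q \<subseteq> M" and K: "ideal K R" and QK: "I = ideal_prod R Q K"
      using factor_below[OF I primeideal] by blast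
    interpret Q: primeideal Q R by fact
    interpret K: ideal K R by fact
    have IQ: "I \<subseteq> Q" unfolding QK using ideal_prod_inter[OF Q.is_ideal K] by blast
    have xaM: "ideal (gen2 (carrier R) x M a) R" by (intro gen2_ideal oneideal is_ideal xc ac)
    \<comment> \<open>Nakayama modulo P: otherwise (1 - \<beta>) a would be a multiple of x for some
      \<beta> in M, so a would be in P.\<close>
    have "a \<notin> gen2 (carrier R) x M a"
    proof
      assume "a \<in> gen2 (carrier R) x M a"
      then obtain \<alpha> \<beta> where m: "\<alpha> \<in> carrier R" "\<beta> \<in> M" and eq: "\<alpha> \<otimes> x \<oplus> \<beta> \<otimes> a = a"
        unfolding gen2_def by force
      note \<beta>c = Icarr[OF m(2)]
      have "(\<one> \<ominus> \<beta>) \<otimes> a = a \<ominus> \<beta> \<otimes> a" using \<beta>c ac by algebra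
      also have "\<dots> = (\<alpha> \<otimes> x \<oplus> \<beta> \<otimes> a) \<ominus> \<beta> \<otimes> a" by (simp only: eq)
      also have "\<dots> = \<alpha> \<otimes> x" using \<beta>c ac m(1) xc by algebra
      finally show False
        using PI[OF ac _ notin_minus[OF _ one_notin m(2)] m(1)] \<beta>c aP by simp
    qed
    \<comment> \<open>Since a is in Q K, some product q r avoids (x) + M a. The coefficient c of a
      in it is then outside M, so q r and x locally generate (x, a).\<close>
    then obtain q r where q: "q \<in> Q" and r: "r \<in> K" and qr: "q \<otimes> r \<notin> gen2 (carrier R) x M a"
      using ideal_prod_subsetI[OF xaM, of Q K] aI QK by blast
    note qc = Q.Icarr[OF q] and rc = K.Icarr[OF r]
    have "q \<otimes> r \<in> I" unfolding QK using q r by (rule ideal_prod.prod)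
    then obtain \<alpha> c where \<alpha>: "\<alpha> \<in> carrier R" and cc: "c \<in> carrier R"
      and eq: "q \<otimes> r = \<alpha> \<otimes> x \<oplus> c \<otimes> a"
      unfolding I_def gen2_def by blast
    have cM: "c \<notin> M" using qr eq \<alpha> unfolding gen2_def by blast
    have "c \<otimes> a \<notin> P" using P.I_prime[OF cc ac] aP cM PM by blast
    moreover have "c \<otimes> a = q \<otimes> r \<ominus> \<alpha> \<otimes> x" unfolding eq using \<alpha> cc xc ac by algebra
    ultimately have qrP: "q \<otimes> r \<notin> P"
      using P.a_closed[OF _ P.a_inv_closed[OF P.I_l_closed[OF xP \<alpha>]]] unfolding a_minus_def by metis
    then have qP: "q \<notin> P" and rP: "r \<notin> P" using P.I_r_closed P.I_l_closed qc rc by blast+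
    \<comment> \<open>Modulo x, z r is w a and q r is c a. Eliminating a puts (c z - q w) r into P,
      and r can be cancelled because P is prime and r is outside it.\<close>
    have Qxq: "\<exists>t\<in>carrier R - M. \<exists>d\<in>carrier R. \<exists>w\<in>carrier R. t \<otimes> z = d \<otimes> x \<oplus> w \<otimes> q" if z: "z \<in> Q" for z
    proof -
      note zc = Q.Icarr[OF z]
      have "z \<otimes> r \<in> I" unfolding QK using z r by (rule ideal_prod.prod)
      then obtain \<beta> w where \<beta>: "\<beta> \<in> carrier R" and w: "w \<in> carrier R"
        and eq': "z \<otimes> r = \<beta> \<otimes> x \<oplus> w \<otimes> a"
        unfolding I_def gen2_def by blast
      have "(c \<otimes> z \<ominus> q \<otimes> w) \<otimes> r = c \<otimes> (z \<otimes> r) \<ominus> w \<otimes> (q \<otimes> r)"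
        using cc zc qc w rc by algebra
      also have "\<dots> = c \<otimes> (\<beta> \<otimes> x \<oplus> w \<otimes> a) \<ominus> w \<otimes> (\<alpha> \<otimes> x \<oplus> c \<otimes> a)" by (simp only: eq eq')
      also have "\<dots> = (c \<otimes> \<beta> \<ominus> w \<otimes> \<alpha>) \<otimes> x" using cc zc qc w rc \<alpha> \<beta> xc ac by algebra
      also have "\<dots> \<in> P" using P.I_l_closed[OF xP] cc \<beta> w \<alpha> by simp
      finally have "c \<otimes> z \<ominus> q \<otimes> w \<in> P"
        using P.I_prime[of "c \<otimes> z \<ominus> q \<otimes> w" r] rP cc zc qc w rc by simp
      then obtain t d where t: "t \<in> carrier R" "t \<notin> M" and d: "d \<in> carrier R"
        and eq'': "t \<otimes> (c \<otimes> z \<ominus> q \<otimes> w) = d \<otimes> x"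
        using PE by blast
      have "(t \<otimes> c) \<otimes> z = t \<otimes> (c \<otimes> z \<ominus> q \<otimes> w) \<oplus> (t \<otimes> w) \<otimes> q"
        using t(1) cc zc qc w by algebra
      also have "\<dots> = d \<otimes> x \<oplus> (t \<otimes> w) \<otimes> q" by (simp only: eq'')
      finally show ?thesis using notin_mult[OF t(1) cc t(2) cM] t(1) cc w d by blast
    qed
    define L where "L = gen2 (carrier R) x (carrier R) (q \<otimes> q)"
    have L: "ideal L R" unfolding L_def using xc qc by (intro gen2_ideal oneideal) auto
    have xL: "x \<in> L" and qqL: "q \<otimes> q \<in> L" unfolding L_def using xc qc by (auto intro: gen2_left gen2_right)
    have "L \<subseteq> Q" unfolding L_def using xI IQ q qc by (intro gen2_subset Q.is_ideal) (auto intro: Q.I_l_closed)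
    then obtain T K' where T: "primeideal T R" "T \<subseteq> Q" and K': "ideal K' R" and TK': "L = ideal_prod R T K'"
      using factor_below[OF L Q(1)] by blast
    interpret T: primeideal T R by fact
    have LT: "L \<subseteq> T" unfolding TK' using ideal_prod_inter[OF T.is_ideal K'] by blast
    show False
    \<comment> \<open>Either x, being in T K', is locally in M (x, q), or K' is locally the unit
      ideal and L is locally the prime T.\<close>
    proof (cases "K' \<subseteq> M")
      case True
      have N: "ideal (gen2 M x M q) R" by (intro gen2_ideal is_ideal xc qc)
      have "ideal_prod R T K' \<subseteq> sat (gen2 M x M q)"
      proof (rule ideal_prod_subsetI[OF sat_ideal[OF N]])
        fix z m assume "z \<in> T" "m \<in> K'"
        then have z: "z \<in> Q" and m: "m \<in> M" using T True by auto
        note zc = Q.Icarr[OF z] and mc = Icarr[OF m]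
        obtain t d w where t: "t \<in> carrier R" "t \<notin> M" and d: "d \<in> carrier R" and w: "w \<in> carrier R"
          and eq: "t \<otimes> z = d \<otimes> x \<oplus> w \<otimes> q"
          using Qxq[OF z] by blast
        have "t \<otimes> (z \<otimes> m) = m \<otimes> (t \<otimes> z)" using t(1) zc mc by algebra
        also have "\<dots> = m \<otimes> (d \<otimes> x \<oplus> w \<otimes> q)" by (simp only: eq)
        also have "\<dots> = (m \<otimes> d) \<otimes> x \<oplus> (m \<otimes> w) \<otimes> q" using mc d w xc qc by algebra
        finally have "t \<otimes> (z \<otimes> m) \<in> gen2 M x M q"
          unfolding gen2_def using I_r_closed[OF m d] I_r_closed[OF m w] by blast
        then show "z \<otimes> m \<in> sat (gen2 M x M q)" using t zc mc by (intro satI[of _ t]) auto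
      qed
      then have "x \<in> sat (gen2 M x M q)" using xL TK' by blast
      then obtain t \<mu> \<nu> where t: "t \<in> carrier R" "t \<notin> M" and \<mu>: "\<mu> \<in> M" and \<nu>: "\<nu> \<in> M"
        and eq: "t \<otimes> x = \<mu> \<otimes> x \<oplus> \<nu> \<otimes> q"
        unfolding sat_def gen2_def by blast
      note \<mu>c = Icarr[OF \<mu>] and \<nu>c = Icarr[OF \<nu>]
      have "\<nu> \<otimes> q = (\<mu> \<otimes> x \<oplus> \<nu> \<otimes> q) \<ominus> \<mu> \<otimes> x" using \<mu>c \<nu>c xc qc by algebra
      also have "\<dots> = t \<otimes> x \<ominus> \<mu> \<otimes> x" by (simp only: eq)
      also have "\<dots> = (t \<ominus> \<mu>) \<otimes> x" using t(1) \<mu>c xc by algebra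
      finally have \<nu>q: "\<nu> \<otimes> q = (t \<ominus> \<mu>) \<otimes> x" .
      have "(t \<ominus> \<mu>) \<otimes> x \<in> P" using P.I_l_closed[OF xP] t(1) \<mu>c by simp
      then have "\<nu> \<in> P" using P.I_prime[OF \<nu>c qc] qP unfolding \<nu>q by blast
      then obtain t' \<delta> where t': "t' \<in> carrier R" "t' \<notin> M" and \<delta>: "\<delta> \<in> carrier R"
        and eq': "t' \<otimes> \<nu> = \<delta> \<otimes> x"
        using PE by blast
      \<comment> \<open>Multiply t x = \<mu> x + \<nu> q by t' and replace t' \<nu> by \<delta> x.
        The resulting coefficient of x is t' t minus an element of M.\<close>
      have "(t' \<otimes> t \<ominus> (t' \<otimes> \<mu> \<oplus> \<delta> \<otimes> q)) \<otimes> x = t' \<otimes> ((t \<ominus> \<mu>) \<otimes> x) \<ominus> (\<delta> \<otimes> x) \<otimes> q"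
        using t(1) t'(1) \<mu>c \<delta> qc xc by algebra
      also have "\<dots> = t' \<otimes> (\<nu> \<otimes> q) \<ominus> (t' \<otimes> \<nu>) \<otimes> q" by (simp only: \<nu>q eq')
      also have "\<dots> = \<zero>" using t'(1) \<nu>c qc by algebra
      finally have "(t' \<otimes> t \<ominus> (t' \<otimes> \<mu> \<oplus> \<delta> \<otimes> q)) \<otimes> x = \<zero>" .
      moreover have "t' \<otimes> \<mu> \<oplus> \<delta> \<otimes> q \<in> M"
        using I_l_closed[OF \<mu> t'(1)] I_l_closed[OF subsetD[OF Q(2) q] \<delta>]
        by (rule additive_subgroup.a_closed[OF is_additive_subgroup])
      then have "t' \<otimes> t \<ominus> (t' \<otimes> \<mu> \<oplus> \<delta> \<otimes> q) \<notin> M"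
        using notin_minus[OF _ notin_mult[OF t'(1) t(1) t'(2) t(2)]] t(1) t'(1) by simp
      ultimately show False using x0 satI[of x "t' \<otimes> t \<ominus> (t' \<otimes> \<mu> \<oplus> \<delta> \<otimes> q)" "{\<zero>}"] t(1) t'(1) \<mu>c \<delta> qc xc
        by simp
    next
      case False
      then obtain u where u: "u \<in> K'" "u \<notin> M" by blast
      note uc = ideal.Icarr[OF K' u(1)]
      \<comment> \<open>As q^2 is in the prime T, so is q, and u carries it into (x, q^2). Nakayama
        modulo x then puts q into P.\<close>
      have "q \<in> T" using T.I_prime[OF qc qc] qqL LT by blast
      then have "q \<otimes> u \<in> L" unfolding TK' using u(1) by (rule ideal_prod.prod)
      then obtain \<alpha> \<beta> where \<alpha>: "\<alpha> \<in> carrier R" and \<beta>: "\<beta> \<in> carrier R"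
        and eq: "q \<otimes> u = \<alpha> \<otimes> x \<oplus> \<beta> \<otimes> (q \<otimes> q)"
        unfolding L_def gen2_def by blast
      have "(u \<ominus> \<beta> \<otimes> q) \<otimes> q = q \<otimes> u \<ominus> \<beta> \<otimes> (q \<otimes> q)" using uc \<beta> qc by algebra
      also have "\<dots> = (\<alpha> \<otimes> x \<oplus> \<beta> \<otimes> (q \<otimes> q)) \<ominus> \<beta> \<otimes> (q \<otimes> q)" by (simp only: eq)
      also have "\<dots> = \<alpha> \<otimes> x" using \<alpha> \<beta> xc qc by algebra
      finally show False
        using PI[OF qc _ notin_minus[OF uc u(2) I_l_closed[OF subsetD[OF Q(2) q] \<beta>]] \<alpha>] qP uc \<beta> qc by simp
    qed
  qed
  then show "a \<in> sat (PIdl x)" by (simp add: P_def)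
qed

lemma sat_zero_subset: "ideal J R \<Longrightarrow> sat {\<zero>} \<subseteq> sat J"
  using additive_subgroup.zero_closed[OF ideal.axioms(1)[of J R]] unfolding sat_def by force

text \<open>For x in N locally outside M N, factor (x) = P K with P inside N. If K were inside M,
  then x would be in M N; so K is locally the unit ideal, and (x) is locally the prime P. Now
  \<open>principal_prime_maximal\<close> puts M inside P, hence inside N.\<close>

lemma nonmaximal_prime_subset_sat:
  assumes N: "primeideal N R" and NM: "N \<subseteq> M" "N \<noteq> M"
  shows "N \<subseteq> sat (ideal_prod R M N)"
proof (rule subsetI, rule ccontr)
  fix x assume xN: "x \<in> N" and x: "x \<notin> sat (ideal_prod R M N)"
  interpret N: primeideal N R by fact
  note xc = N.Icarr[OF xN]
  have MN: "ideal (ideal_prod R M N) R" by (rule ideal_prod_is_ideal[OF is_ideal N.is_ideal])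
  have "PIdl x \<subseteq> N" by (rule cgenideal_minimal[OF N.is_ideal xN])
  then obtain P K where P: "primeideal P R" "P \<subseteq> N" and K: "ideal K R" and PK: "PIdl x = ideal_prod R P K"
    using factor_below[OF cgenideal_ideal[OF xc] N] by blast
  interpret P: primeideal P R by fact
  have xPK: "x \<in> ideal_prod R P K" using cgenideal_self[OF xc] PK by simp
  have "\<not> K \<subseteq> M"
  proof
    assume "K \<subseteq> M"
    then have "ideal_prod R K P \<subseteq> ideal_prod R M N"
      using P(2) by (intro ideal_prod_subsetI[OF MN] ideal_prod.prod) auto
    then show False using x xPK subset_sat[OF MN] ideal_prod_commute[OF K P.is_ideal] by blast
  qed
  then obtain u where u: "u \<in> K" "u \<notin> M" by blast
  note uc = ideal.Icarr[OF K u(1)]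
  have "sat (PIdl x) = P"
  proof
    show "P \<subseteq> sat (PIdl x)"
    proof
      fix z assume z: "z \<in> P"
      have "u \<otimes> z \<in> PIdl x"
        using ideal_prod.prod[OF z u(1), of R] PK m_comm[OF uc P.Icarr[OF z]] by simp
      then show "z \<in> sat (PIdl x)" using satI[OF P.Icarr[OF z] uc u(2)] by blast
    qed
    show "sat (PIdl x) \<subseteq> P"
    proof
      fix z assume "z \<in> sat (PIdl x)"
      then obtain t where t: "z \<in> carrier R" "t \<in> carrier R" "t \<notin> M" "t \<otimes> z \<in> PIdl x"
        unfolding sat_def by blast
      then have "t \<otimes> z \<in> P" using ideal_prod_inter[OF P.is_ideal K] PK by blast
      then show "z \<in> P" using P.I_prime[of t z] t P(2) NM(1) by blast
    qed
  qed
  moreover have "x \<notin> sat {\<zero>}" using x sat_zero_subset[OF MN] by blast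
  ultimately have "M \<subseteq> P" using principal_prime_maximal[of x] xN NM(1) P(1) by auto
  then show False using P(2) NM by blast
qed

section \<open>Powers of M and local comparability\<close>

abbreviation M_power :: "nat \<Rightarrow> 'a set" where
  "M_power n \<equiv> ideal_prod_list R (replicate n M)"

lemma M_power_ideal: "ideal (M_power n) R"
  using is_ideal by (intro ideal_prod_list_ideal) auto

lemma M_power_antimono: "m \<le> n \<Longrightarrow> M_power n \<subseteq> M_power m"
proof (rule lift_Suc_antimono_le[of "\<lambda>n. M_power n"])
  show "M_power (Suc k) \<subseteq> M_power k" for k
    using ideal_prod_inter[OF is_ideal M_power_ideal[of k]] by auto
qed

text \<open>A factor not inside M is locally the unit ideal, so n counts the factors equal to M. The
  element u is a product of elements outside M, one from each other factor, and therefore serves all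
  z at once.\<close>

lemma locally_M_power:
  assumes "\<And>P. P \<in> set Ps \<Longrightarrow> ideal P R \<and> (P = M \<or> \<not> P \<subseteq> M)"
  shows "\<exists>n. \<exists>u\<in>carrier R - M. ideal_prod_list R Ps \<subseteq> M_power n \<and>
           (\<forall>z\<in>M_power n. u \<otimes> z \<in> ideal_prod_list R Ps)"
  using assms
proof (induction Ps)
  case Nil
  have "ideal_prod_list R [] \<subseteq> M_power 0 \<and> (\<forall>z\<in>M_power 0. \<one> \<otimes> z \<in> ideal_prod_list R [])" by simp
  then show ?case using one_notin one_closed by blast
next
  case (Cons P Ps)
  then obtain n u where u: "u \<in> carrier R" "u \<notin> M" and sub: "ideal_prod_list R Ps \<subseteq> M_power n"
    and mem: "\<And>z. z \<in> M_power n \<Longrightarrow> u \<otimes> z \<in> ideal_prod_list R Ps"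
    by (auto simp: Ball_def)
  have P: "ideal P R" and PM: "P = M \<or> \<not> P \<subseteq> M" and L: "ideal (ideal_prod_list R Ps) R"
    using Cons.prems by (auto intro: ideal_prod_list_ideal)
  from PM show ?case
  proof
    assume PM: "P = M"
    let ?J = "ideal_prod_list R (P # Ps)"
    have MnI: "ideal (M_power (Suc n)) R" by (rule M_power_ideal)
    have "?J \<subseteq> M_power (Suc n)"
      unfolding PM ideal_prod_list_Cons
    proof (rule ideal_prod_subsetI[OF MnI])
      fix i j assume "i \<in> M" "j \<in> ideal_prod_list R Ps"
      then show "i \<otimes> j \<in> M_power (Suc n)" using sub ideal_prod.prod[of i M j _ R] by auto
    qed
    moreover have "u \<otimes> z \<in> ?J" if "z \<in> M_power (Suc n)" for z
    proof -
      have J: "ideal ?J R" using ideal_prod_is_ideal[OF P L] by simp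
      have "ideal_prod R M (M_power n) \<subseteq> {x \<in> carrier R. u \<otimes> x \<in> ?J}"
      proof (rule ideal_prod_subsetI[OF ideal.helper_max_prime[OF J is_cring u(1)]])
        fix m k assume m: "m \<in> M" and k: "k \<in> M_power n"
        note mc = Icarr[OF m] and kc = ideal.Icarr[OF M_power_ideal k]
        have "u \<otimes> (m \<otimes> k) = m \<otimes> (u \<otimes> k)" using u(1) mc kc by algebra
        also have "\<dots> \<in> ?J" using ideal_prod.prod[OF m mem[OF k], of R] PM by simp
        finally show "m \<otimes> k \<in> {x \<in> carrier R. u \<otimes> x \<in> ?J}" using mc kc by simp
      qed
      then show ?thesis using that by auto
    qed
    ultimately show ?thesis using u by blast
  next
    assume "\<not> P \<subseteq> M"
    then obtain p where p: "p \<in> P" "p \<notin> M" by blast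
    note pc = ideal.Icarr[OF P p(1)]
    have "ideal_prod_list R (P # Ps) \<subseteq> M_power n"
      using ideal_prod_inter[OF P L] sub by auto
    moreover have "(p \<otimes> u) \<otimes> z \<in> ideal_prod_list R (P # Ps)" if z: "z \<in> M_power n" for z
      using ideal_prod.prod[OF p(1) mem[OF z], of R] m_assoc[OF pc u(1) ideal.Icarr[OF M_power_ideal z]]
      by simp
    ultimately show ?thesis using notin_mult[OF pc u(1) p(2) u(2)] pc u(1) by blast
  qed
qed

text \<open>A prime factor P properly inside M satisfies P = M P locally, so (x) = P K = M P K = M
  (x) locally. This gives t x = \<mu> x with \<mu> in M, and x would be locally zero.\<close>

lemma principal_locally_M_power:
  assumes x: "x \<in> M" and x0: "x \<notin> sat {\<zero>}"
  shows "\<exists>n. \<exists>u\<in>carrier R - M. x \<in> M_power n \<and> (\<forall>z\<in>M_power n. u \<otimes> z \<in> PIdl x)"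
proof -
  note xc = Icarr[OF x]
  have "PIdl x \<subseteq> M" by (rule cgenideal_minimal[OF is_ideal x])
  then have "PIdl x \<noteq> carrier R" using I_notcarr Icarr by blast
  then obtain Ps where Ps: "\<forall>P\<in>set Ps. primeideal P R" and PIdl: "PIdl x = ideal_prod_list R Ps"
    using factorization[OF cgenideal_ideal[OF xc]] by blast
  have i: "\<And>P. P \<in> set Ps \<Longrightarrow> ideal P R" using Ps by (auto dest: primeideal.axioms(1))
  have "P = M \<or> \<not> P \<subseteq> M" if P: "P \<in> set Ps" for P
  proof (rule ccontr)
    assume *: "\<not> (P = M \<or> \<not> P \<subseteq> M)"
    interpret P: primeideal P R using P Ps by blast
    obtain K where K: "ideal K R" and PK: "PIdl x = ideal_prod R P K"
      using ideal_prod_list_factor[OF P i] PIdl by auto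
    have Mx: "ideal {\<mu> \<otimes> x |\<mu>. \<mu> \<in> M} R"
    proof -
      have "{\<mu> \<otimes> x |\<mu>. \<mu> \<in> M} = gen2 M x M \<zero>"
        unfolding gen2_def using Icarr xc zero_closed by force
      then show ?thesis using gen2_ideal[OF is_ideal is_ideal xc] by simp
    qed
    have "ideal_prod R M (PIdl x) \<subseteq> {\<mu> \<otimes> x |\<mu>. \<mu> \<in> M}"
    proof (rule ideal_prod_subsetI[OF Mx])
      fix m j assume m: "m \<in> M" and "j \<in> PIdl x"
      then obtain c where c: "c \<in> carrier R" "j = c \<otimes> x" unfolding PIdl_iff by blast
      have "m \<otimes> j = (m \<otimes> c) \<otimes> x" unfolding c(2) using m_assoc[OF Icarr[OF m] c(1) xc] by simp
      then show "m \<otimes> j \<in> {\<mu> \<otimes> x |\<mu>. \<mu> \<in> M}" using I_r_closed[OF m c(1)] by blast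
    qed
    moreover have "ideal_prod R P K \<subseteq> sat (ideal_prod R M (PIdl x))"
    proof (rule ideal_prod_subsetI[OF sat_ideal])
      show "ideal (ideal_prod R M (PIdl x)) R" by (intro ideal_prod_is_ideal is_ideal cgenideal_ideal xc)
      fix z k assume z: "z \<in> P" and k: "k \<in> K"
      note zc = P.Icarr[OF z] and kc = ideal.Icarr[OF K k]
      obtain t where t: "t \<in> carrier R" "t \<notin> M" "t \<otimes> z \<in> ideal_prod R M P"
        using nonmaximal_prime_subset_sat[OF P.primeideal] * z unfolding sat_def by blast
      have "t \<otimes> (z \<otimes> k) = (t \<otimes> z) \<otimes> k" using t(1) zc kc by (simp add: m_assoc)
      also have "\<dots> \<in> ideal_prod R (ideal_prod R M P) K" using t(3) k by (rule ideal_prod.prod)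
      also have "\<dots> = ideal_prod R M (PIdl x)"
        unfolding PK using ideal_prod_assoc[OF is_ideal P.is_ideal K] .
      finally show "z \<otimes> k \<in> sat (ideal_prod R M (PIdl x))" using t zc kc by (intro satI[of _ t]) auto
    qed
    ultimately have "x \<in> sat {\<mu> \<otimes> x |\<mu>. \<mu> \<in> M}"
      using cgenideal_self[OF xc] unfolding PK sat_def by blast
    then obtain t \<mu> where t: "t \<in> carrier R" "t \<notin> M" and \<mu>: "\<mu> \<in> M" and eq: "t \<otimes> x = \<mu> \<otimes> x"
      unfolding sat_def by blast
    note \<mu>c = Icarr[OF \<mu>]
    have "(t \<ominus> \<mu>) \<otimes> x = t \<otimes> x \<ominus> \<mu> \<otimes> x" using t(1) \<mu>c xc by algebra
    also have "\<dots> = \<mu> \<otimes> x \<ominus> \<mu> \<otimes> x" by (simp only: eq)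
    also have "\<dots> = \<zero>" using \<mu>c xc by simp
    finally show False using x0 satI[OF xc _ notin_minus[OF t \<mu>], of "{\<zero>}"] t(1) \<mu>c by simp
  qed
  then obtain n u where u: "u \<in> carrier R - M" "PIdl x \<subseteq> M_power n" "\<forall>z\<in>M_power n. u \<otimes> z \<in> PIdl x"
    using locally_M_power[of Ps] i unfolding PIdl by blast
  then show ?thesis using cgenideal_self[OF xc] by blast
qed

lemma locally_comparable:
  assumes x: "x \<in> carrier R" and y: "y \<in> carrier R"
  shows "\<exists>t\<in>carrier R - M. t \<otimes> x \<in> PIdl y \<or> t \<otimes> y \<in> PIdl x"
proof -
  \<comment> \<open>An element outside M serves as its own multiplier t.\<close>
  have "x \<otimes> y \<in> PIdl x" "y \<otimes> x \<in> PIdl y"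
    unfolding PIdl_iff using m_comm[OF x y] x y by metis+
  then have unit: "?thesis" if "x \<notin> M \<or> y \<notin> M"
    using that x y by blast
  have zero: "\<exists>t\<in>carrier R - M. t \<otimes> a \<in> PIdl b" if "a \<in> sat {\<zero>}" "b \<in> carrier R" for a b
    using that additive_subgroup.zero_closed[OF ideal.axioms(1)[OF cgenideal_ideal[of b]]]
    unfolding sat_def by force
  show ?thesis
  proof (cases "x \<in> M \<and> y \<in> M \<and> x \<notin> sat {\<zero>} \<and> y \<notin> sat {\<zero>}")
    case True
    obtain m u where u: "u \<in> carrier R - M" "x \<in> M_power m" "\<And>z. z \<in> M_power m \<Longrightarrow> u \<otimes> z \<in> PIdl x"
      using principal_locally_M_power[of x] True by blast
    obtain n v where v: "v \<in> carrier R - M" "y \<in> M_power n" "\<And>z. z \<in> M_power n \<Longrightarrow> v \<otimes> z \<in> PIdl y"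
      using principal_locally_M_power[of y] True by blast
    show ?thesis
    proof (cases "m \<le> n")
      case True
      then show ?thesis using M_power_antimono[of m n] u v by blast
    next
      case False
      then show ?thesis using M_power_antimono[of n m] u v by force
    qed
  next
    case False
    then show ?thesis using unit zero x y by blast
  qed
qed

end

section \<open>Localization\<close>

locale mult_subset = cring R for R (structure) +
  fixes S :: "'a set"
  assumes S_carr: "S \<subseteq> carrier R"
    and one_S: "\<one> \<in> S"
    and mult_S: "\<lbrakk>s \<in> S; t \<in> S\<rbrakk> \<Longrightarrow> s \<otimes> t \<in> S"
begin

abbreviation mk_frac :: "'a \<Rightarrow> 'a \<Rightarrow> ('a \<times> 'a) set" where
  "mk_frac r s \<equiv> frac_rel R S `` {(r, s)}"

abbreviation L :: "('a \<times> 'a) set ring" where "L \<equiv> localization_ring R S"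

lemma S_c: "s \<in> S \<Longrightarrow> s \<in> carrier R"
  using S_carr by blast

lemma frac_rel_iff:
  assumes "r \<in> carrier R" "s \<in> S" "r' \<in> carrier R" "s' \<in> S"
  shows "((r, s), (r', s')) \<in> frac_rel R S \<longleftrightarrow> (\<exists>t\<in>S. t \<otimes> (s' \<otimes> r) = t \<otimes> (s \<otimes> r'))"
proof -
  have "t \<otimes> (s' \<otimes> r \<ominus> s \<otimes> r') = \<zero> \<longleftrightarrow> t \<otimes> (s' \<otimes> r) = t \<otimes> (s \<otimes> r')" if t: "t \<in> S" for t
  proof -
    have "t \<otimes> (s' \<otimes> r \<ominus> s \<otimes> r') = t \<otimes> (s' \<otimes> r) \<ominus> t \<otimes> (s \<otimes> r')"
      using assms(1,3) S_c[OF assms(2)] S_c[OF assms(4)] S_c[OF t] by algebra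
    then show ?thesis using assms S_c t by simp
  qed
  then show ?thesis using assms by (auto simp: frac_rel_def)
qed

lemma equiv_frac: "equiv (carrier R \<times> S) (frac_rel R S)"
proof (rule equivI)
  show "frac_rel R S \<subseteq> (carrier R \<times> S) \<times> (carrier R \<times> S)" by (auto simp: frac_rel_def)
  show "refl_on (carrier R \<times> S) (frac_rel R S)"
    using one_S by (auto simp: refl_on_def frac_rel_iff)
  show "sym (frac_rel R S)"
  proof (rule symI, clarify)
    fix r s r' s' assume *: "((r, s), (r', s')) \<in> frac_rel R S"
    then have "r \<in> carrier R" "s \<in> S" "r' \<in> carrier R" "s' \<in> S" by (auto simp: frac_rel_def)
    then show "((r', s'), (r, s)) \<in> frac_rel R S" using * by (force simp: frac_rel_iff)
  qed
  show "trans (frac_rel R S)"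
  proof (rule transI, clarify)
    fix a s b t c u
    assume 1: "((a, s), (b, t)) \<in> frac_rel R S" and 2: "((b, t), (c, u)) \<in> frac_rel R S"
    have m: "a \<in> carrier R" "s \<in> S" "b \<in> carrier R" "t \<in> S" "c \<in> carrier R" "u \<in> S"
      using 1 2 by (auto simp: frac_rel_def)
    note sc = S_c[OF m(2)] S_c[OF m(4)] S_c[OF m(6)]
    obtain p where p: "p \<in> S" "p \<otimes> (t \<otimes> a) = p \<otimes> (s \<otimes> b)" using 1 m by (auto simp: frac_rel_iff)
    obtain q where q: "q \<in> S" "q \<otimes> (u \<otimes> b) = q \<otimes> (t \<otimes> c)" using 2 m by (auto simp: frac_rel_iff)
    note pc = S_c[OF p(1)] and qc = S_c[OF q(1)]
    \<comment> \<open>The multiplier is p q t: the middle denominator t must be present for both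
      hypotheses to apply.\<close>
    have "(p \<otimes> q \<otimes> t) \<otimes> (u \<otimes> a) = q \<otimes> u \<otimes> (p \<otimes> (t \<otimes> a))" using m(1) sc pc qc by algebra
    also have "\<dots> = q \<otimes> u \<otimes> (p \<otimes> (s \<otimes> b))" by (simp only: p(2))
    also have "\<dots> = p \<otimes> s \<otimes> (q \<otimes> (u \<otimes> b))" using m(3) sc pc qc by algebra
    also have "\<dots> = p \<otimes> s \<otimes> (q \<otimes> (t \<otimes> c))" by (simp only: q(2))
    also have "\<dots> = (p \<otimes> q \<otimes> t) \<otimes> (s \<otimes> c)" using m(5) sc pc qc by algebra
    finally show "((a, s), (c, u)) \<in> frac_rel R S"
      using m p(1) q(1) mult_S by (auto simp: frac_rel_iff)
  qed
qed

lemma frac_eq_iff: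
  assumes "r \<in> carrier R" "s \<in> S" "r' \<in> carrier R" "s' \<in> S"
  shows "mk_frac r s = mk_frac r' s' \<longleftrightarrow> (\<exists>t\<in>S. t \<otimes> (s' \<otimes> r) = t \<otimes> (s \<otimes> r'))"
  using eq_equiv_class_iff[OF equiv_frac, of "(r, s)" "(r', s')"] assms frac_rel_iff[OF assms] by simp

lemma frac_eqI:
  assumes "r \<in> carrier R" "s \<in> S" "r' \<in> carrier R" "s' \<in> S" "s' \<otimes> r = s \<otimes> r'"
  shows "mk_frac r s = mk_frac r' s'"
  using frac_eq_iff[OF assms(1-4)] one_S assms(5) by auto

lemma carrier_L: "carrier L = {mk_frac r s |r s. r \<in> carrier R \<and> s \<in> S}"
  by (auto simp: localization_ring_def quotient_def)

lemma one_L: "\<one>\<^bsub>L\<^esub> = mk_frac \<one> \<one>" and zero_L: "\<zero>\<^bsub>L\<^esub> = mk_frac \<zero> \<one>"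
  by (simp_all add: localization_ring_def)

lemma frac_closed: "r \<in> carrier R \<Longrightarrow> s \<in> S \<Longrightarrow> mk_frac r s \<in> carrier L"
  unfolding carrier_L by blast

text \<open>The operations of \<open>localization_ring\<close> are unions over representatives. Once
  the value is independent of these, the union collapses to it, so well-definedness is all that
  \<open>mult_L\<close> and \<open>add_L\<close> have to check.\<close>

lemma UN_frac:
  assumes c: "r \<in> carrier R" "s \<in> S" "r' \<in> carrier R" "s' \<in> S"
    and f: "\<And>a u b v. \<lbrakk>a \<in> carrier R; u \<in> S; b \<in> carrier R; v \<in> S; mk_frac r s = mk_frac a u; mk_frac r' s' = mk_frac b v\<rbrakk>
      \<Longrightarrow> f a u b v = X"
  shows "(\<Union>(a, u)\<in>mk_frac r s. \<Union>(b, v)\<in>mk_frac r' s'. f a u b v) = X"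
proof -
  have val: "f a u b v = X" if "(a, u) \<in> mk_frac r s" "(b, v) \<in> mk_frac r' s'" for a u b v
  proof -
    have "a \<in> carrier R" "u \<in> S" "b \<in> carrier R" "v \<in> S" using that by (auto simp: frac_rel_def)
    moreover have "mk_frac r s = mk_frac a u" "mk_frac r' s' = mk_frac b v"
      using that equiv_class_eq[OF equiv_frac] by auto
    ultimately show ?thesis using f by blast
  qed
  have self: "(r, s) \<in> mk_frac r s" "(r', s') \<in> mk_frac r' s'"
    using equiv_class_self[OF equiv_frac] c by auto
  show ?thesis
  proof (intro equalityI subsetI)
    fix z assume "z \<in> (\<Union>(a, u)\<in>mk_frac r s. \<Union>(b, v)\<in>mk_frac r' s'. f a u b v)"
    then obtain a u b v where "(a, u) \<in> mk_frac r s" "(b, v) \<in> mk_frac r' s'" "z \<in> f a u b v"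
      by blast
    then show "z \<in> X" using val[of a u b v] by simp
  next
    fix z assume "z \<in> X"
    then have "z \<in> f r s r' s'" using val[OF self] by simp
    then show "z \<in> (\<Union>(a, u)\<in>mk_frac r s. \<Union>(b, v)\<in>mk_frac r' s'. f a u b v)"
      using self by blast
  qed
qed

lemma mult_L:
  assumes c: "r \<in> carrier R" "s \<in> S" "r' \<in> carrier R" "s' \<in> S"
  shows "mk_frac r s \<otimes>\<^bsub>L\<^esub> mk_frac r' s' = mk_frac (r \<otimes> r') (s \<otimes> s')"
proof -
  have wd: "mk_frac (a \<otimes> b) (u \<otimes> v) = mk_frac (r \<otimes> r') (s \<otimes> s')"
    if m: "a \<in> carrier R" "u \<in> S" "b \<in> carrier R" "v \<in> S"
      and eq: "mk_frac r s = mk_frac a u" "mk_frac r' s' = mk_frac b v" for a u b v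
  proof -
    note sc = S_c[OF c(2)] S_c[OF c(4)] S_c[OF m(2)] S_c[OF m(4)]
    obtain p where p: "p \<in> S" "p \<otimes> (u \<otimes> r) = p \<otimes> (s \<otimes> a)" using eq(1) frac_eq_iff c m by auto
    obtain q where q: "q \<in> S" "q \<otimes> (v \<otimes> r') = q \<otimes> (s' \<otimes> b)" using eq(2) frac_eq_iff c m by auto
    note pc = S_c[OF p(1)] and qc = S_c[OF q(1)]
    have "(p \<otimes> q) \<otimes> ((s \<otimes> s') \<otimes> (a \<otimes> b)) = (p \<otimes> (s \<otimes> a)) \<otimes> (q \<otimes> (s' \<otimes> b))"
      using m(1,3) sc pc qc by algebra
    also have "\<dots> = (p \<otimes> (u \<otimes> r)) \<otimes> (q \<otimes> (v \<otimes> r'))" by (simp only: p(2) q(2))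
    also have "\<dots> = (p \<otimes> q) \<otimes> ((u \<otimes> v) \<otimes> (r \<otimes> r'))" using c(1,3) sc pc qc by algebra
    finally show ?thesis
      using frac_eq_iff[of "a \<otimes> b" "u \<otimes> v" "r \<otimes> r'" "s \<otimes> s'"] c m mult_S p(1) q(1) by blast
  qed
  have "mk_frac r s \<otimes>\<^bsub>L\<^esub> mk_frac r' s' =
      (\<Union>(a, u)\<in>mk_frac r s. \<Union>(b, v)\<in>mk_frac r' s'. mk_frac (a \<otimes> b) (u \<otimes> v))"
    by (simp add: localization_ring_def)
  also have "\<dots> = mk_frac (r \<otimes> r') (s \<otimes> s')"
    by (rule UN_frac[OF c wd])
  finally show ?thesis .
qed

lemma add_L:
  assumes c: "r \<in> carrier R" "s \<in> S" "r' \<in> carrier R" "s' \<in> S"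
  shows "mk_frac r s \<oplus>\<^bsub>L\<^esub> mk_frac r' s' = mk_frac (s' \<otimes> r \<oplus> s \<otimes> r') (s \<otimes> s')"
proof -
  have wd: "mk_frac (v \<otimes> a \<oplus> u \<otimes> b) (u \<otimes> v) = mk_frac (s' \<otimes> r \<oplus> s \<otimes> r') (s \<otimes> s')"
    if m: "a \<in> carrier R" "u \<in> S" "b \<in> carrier R" "v \<in> S"
      and eq: "mk_frac r s = mk_frac a u" "mk_frac r' s' = mk_frac b v" for a u b v
  proof -
    note sc = S_c[OF c(2)] S_c[OF c(4)] S_c[OF m(2)] S_c[OF m(4)]
    obtain p where p: "p \<in> S" "p \<otimes> (u \<otimes> r) = p \<otimes> (s \<otimes> a)" using eq(1) frac_eq_iff c m by auto
    obtain q where q: "q \<in> S" "q \<otimes> (v \<otimes> r') = q \<otimes> (s' \<otimes> b)" using eq(2) frac_eq_iff c m by auto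
    note pc = S_c[OF p(1)] and qc = S_c[OF q(1)]
    have "(p \<otimes> q) \<otimes> ((s \<otimes> s') \<otimes> (v \<otimes> a \<oplus> u \<otimes> b)) =
        q \<otimes> s' \<otimes> v \<otimes> (p \<otimes> (s \<otimes> a)) \<oplus> p \<otimes> s \<otimes> u \<otimes> (q \<otimes> (s' \<otimes> b))"
      using m(1,3) sc pc qc by algebra
    also have "\<dots> = q \<otimes> s' \<otimes> v \<otimes> (p \<otimes> (u \<otimes> r)) \<oplus> p \<otimes> s \<otimes> u \<otimes> (q \<otimes> (v \<otimes> r'))" by (simp only: p(2) q(2))
    also have "\<dots> = (p \<otimes> q) \<otimes> ((u \<otimes> v) \<otimes> (s' \<otimes> r \<oplus> s \<otimes> r'))" using c(1,3) sc pc qc by algebra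
    finally show ?thesis
      using frac_eq_iff[of "v \<otimes> a \<oplus> u \<otimes> b" "u \<otimes> v" "s' \<otimes> r \<oplus> s \<otimes> r'" "s \<otimes> s'"] c m mult_S p(1) q(1) S_c
      by simp blast
  qed
  have "mk_frac r s \<oplus>\<^bsub>L\<^esub> mk_frac r' s' =
      (\<Union>(a, u)\<in>mk_frac r s. \<Union>(b, v)\<in>mk_frac r' s'. mk_frac (v \<otimes> a \<oplus> u \<otimes> b) (u \<otimes> v))"
    by (simp add: localization_ring_def)
  also have "\<dots> = mk_frac (s' \<otimes> r \<oplus> s \<otimes> r') (s \<otimes> s')"
    by (rule UN_frac[OF c wd])
  finally show ?thesis .
qed

lemma cring_L: "cring L"
proof (rule cringI)
  have elim: "\<exists>r s. r \<in> carrier R \<and> s \<in> S \<and> x = mk_frac r s" if "x \<in> carrier L" for x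
    using that unfolding carrier_L by blast
  show "abelian_group L"
  proof (rule abelian_groupI)
    show "x \<oplus>\<^bsub>L\<^esub> y \<in> carrier L" if "x \<in> carrier L" "y \<in> carrier L" for x y
      using elim[OF that(1)] elim[OF that(2)] S_c mult_S by (auto simp: add_L intro!: frac_closed)
    show "\<zero>\<^bsub>L\<^esub> \<in> carrier L" unfolding zero_L by (intro frac_closed zero_closed one_S)
    show "x \<oplus>\<^bsub>L\<^esub> y \<oplus>\<^bsub>L\<^esub> z = x \<oplus>\<^bsub>L\<^esub> (y \<oplus>\<^bsub>L\<^esub> z)"
      if xyz: "x \<in> carrier L" "y \<in> carrier L" "z \<in> carrier L" for x y z
    proof -
      obtain a s b t c u where e: "a \<in> carrier R" "s \<in> S" "b \<in> carrier R" "t \<in> S" "c \<in> carrier R" "u \<in> S"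
        and eq: "x = mk_frac a s" "y = mk_frac b t" "z = mk_frac c u"
        using xyz[THEN elim] by blast
      note sc = S_c[OF e(2)] S_c[OF e(4)] S_c[OF e(6)]
      have "u \<otimes> (t \<otimes> a \<oplus> s \<otimes> b) \<oplus> s \<otimes> t \<otimes> c = t \<otimes> u \<otimes> a \<oplus> s \<otimes> (u \<otimes> b \<oplus> t \<otimes> c)"
        using e(1,3,5) sc by algebra
      then show ?thesis unfolding eq using e sc mult_S by (simp add: add_L m_assoc)
    qed
    show "x \<oplus>\<^bsub>L\<^esub> y = y \<oplus>\<^bsub>L\<^esub> x" if xy: "x \<in> carrier L" "y \<in> carrier L" for x y
    proof -
      obtain a s b t where e: "a \<in> carrier R" "s \<in> S" "b \<in> carrier R" "t \<in> S"
        and eq: "x = mk_frac a s" "y = mk_frac b t"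
        using xy[THEN elim] by blast
      then show ?thesis using S_c by (simp add: add_L a_comm m_comm)
    qed
    show "\<zero>\<^bsub>L\<^esub> \<oplus>\<^bsub>L\<^esub> x = x" if "x \<in> carrier L" for x
      using elim[OF that] S_c one_S by (auto simp: add_L zero_L)
    show "\<exists>y\<in>carrier L. y \<oplus>\<^bsub>L\<^esub> x = \<zero>\<^bsub>L\<^esub>" if "x \<in> carrier L" for x
    proof -
      obtain a s where e: "a \<in> carrier R" "s \<in> S" and eq: "x = mk_frac a s"
        using elim[OF \<open>x \<in> carrier L\<close>] by blast
      have "s \<otimes> \<ominus> a \<oplus> s \<otimes> a = \<zero>" using e(1) S_c[OF e(2)] by algebra
      then have "mk_frac (\<ominus> a) s \<oplus>\<^bsub>L\<^esub> mk_frac a s = mk_frac \<zero> (s \<otimes> s)" using e by (simp add: add_L)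
      also have "\<dots> = \<zero>\<^bsub>L\<^esub>" unfolding zero_L using e S_c mult_S one_S by (intro frac_eqI) auto
      finally show ?thesis unfolding eq using frac_closed e a_inv_closed by blast
    qed
  qed
  show "comm_monoid L"
  proof (rule comm_monoidI)
    show "x \<otimes>\<^bsub>L\<^esub> y \<in> carrier L" if "x \<in> carrier L" "y \<in> carrier L" for x y
      using elim[OF that(1)] elim[OF that(2)] mult_S by (auto simp: mult_L intro!: frac_closed)
    show "\<one>\<^bsub>L\<^esub> \<in> carrier L" unfolding one_L by (intro frac_closed one_closed one_S)
    show "x \<otimes>\<^bsub>L\<^esub> y \<otimes>\<^bsub>L\<^esub> z = x \<otimes>\<^bsub>L\<^esub> (y \<otimes>\<^bsub>L\<^esub> z)"
      if "x \<in> carrier L" "y \<in> carrier L" "z \<in> carrier L" for x y z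
      using elim[OF that(1)] elim[OF that(2)] elim[OF that(3)] S_c mult_S by (auto simp: mult_L m_assoc)
    show "x \<otimes>\<^bsub>L\<^esub> y = y \<otimes>\<^bsub>L\<^esub> x" if "x \<in> carrier L" "y \<in> carrier L" for x y
      using elim[OF that(1)] elim[OF that(2)] S_c by (auto simp: mult_L m_comm)
    show "\<one>\<^bsub>L\<^esub> \<otimes>\<^bsub>L\<^esub> x = x" if "x \<in> carrier L" for x
      using elim[OF that] S_c one_S by (auto simp: mult_L one_L)
  qed
  show "(x \<oplus>\<^bsub>L\<^esub> y) \<otimes>\<^bsub>L\<^esub> z = x \<otimes>\<^bsub>L\<^esub> z \<oplus>\<^bsub>L\<^esub> y \<otimes>\<^bsub>L\<^esub> z"
    if xyz: "x \<in> carrier L" "y \<in> carrier L" "z \<in> carrier L" for x y z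
  proof -
    obtain a s b t c u where e: "a \<in> carrier R" "s \<in> S" "b \<in> carrier R" "t \<in> S" "c \<in> carrier R" "u \<in> S"
      and eq: "x = mk_frac a s" "y = mk_frac b t" "z = mk_frac c u"
      using xyz[THEN elim] by blast
    note sc = S_c[OF e(2)] S_c[OF e(4)] S_c[OF e(6)]
    \<comment> \<open>The two sides of distributivity arrive with denominators s t u and (s u) (t
      u), and their numerators differ by the same factor u.\<close>
    have 1: "u \<otimes> ((t \<otimes> a \<oplus> s \<otimes> b) \<otimes> c) = t \<otimes> u \<otimes> (a \<otimes> c) \<oplus> s \<otimes> u \<otimes> (b \<otimes> c)"
      using e(1,3,5) sc by algebra
    have 2: "s \<otimes> u \<otimes> (t \<otimes> u) \<otimes> d = s \<otimes> t \<otimes> u \<otimes> (u \<otimes> d)" if "d \<in> carrier R" for d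
      using that sc by algebra
    have "(t \<otimes> a \<oplus> s \<otimes> b) \<otimes> c \<in> carrier R" using e(1,3,5) sc by simp
    from 2[OF this] have 3: "s \<otimes> u \<otimes> (t \<otimes> u) \<otimes> ((t \<otimes> a \<oplus> s \<otimes> b) \<otimes> c) =
      s \<otimes> t \<otimes> u \<otimes> (t \<otimes> u \<otimes> (a \<otimes> c) \<oplus> s \<otimes> u \<otimes> (b \<otimes> c))"
      by (simp only: 1)
    have "(x \<oplus>\<^bsub>L\<^esub> y) \<otimes>\<^bsub>L\<^esub> z = mk_frac ((t \<otimes> a \<oplus> s \<otimes> b) \<otimes> c) (s \<otimes> t \<otimes> u)"
      unfolding eq using e sc mult_S by (simp add: add_L mult_L)
    also have "\<dots> = mk_frac (t \<otimes> u \<otimes> (a \<otimes> c) \<oplus> s \<otimes> u \<otimes> (b \<otimes> c)) (s \<otimes> u \<otimes> (t \<otimes> u))"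
      using e sc mult_S by (intro frac_eqI 3) auto
    also have "\<dots> = x \<otimes>\<^bsub>L\<^esub> z \<oplus>\<^bsub>L\<^esub> y \<otimes>\<^bsub>L\<^esub> z"
      unfolding eq using e sc mult_S by (simp add: add_L mult_L)
    finally show ?thesis .
  qed
qed

text \<open>The bridge between the quotient construction and equations of R, crossed in both
  directions below. Comparing principal ideals is enough: an element of J outside I is no multiple
  of any element of I, so every element of I is a multiple of it. Denominators are units and may be
  dropped.\<close>

lemma chained_L_iff:
  "chained_ring L \<longleftrightarrow>
     (\<forall>x\<in>carrier R. \<forall>y\<in>carrier R. \<exists>t\<in>S. t \<otimes> x \<in> PIdl y \<or> t \<otimes> y \<in> PIdl x)"
proof
  interpret L: cring L by (rule cring_L)
  assume chained: "chained_ring L"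
  show "\<forall>x\<in>carrier R. \<forall>y\<in>carrier R. \<exists>t\<in>S. t \<otimes> x \<in> PIdl y \<or> t \<otimes> y \<in> PIdl x"
  proof (intro ballI)
    fix x y assume x: "x \<in> carrier R" and y: "y \<in> carrier R"
    have L: "mk_frac x \<one> \<in> carrier L" "mk_frac y \<one> \<in> carrier L" using x y one_S by (auto intro: frac_closed)
    have *: "\<exists>t\<in>S. t \<otimes> a \<in> PIdl b"
      if a: "a \<in> carrier R" and b: "b \<in> carrier R" and sub: "PIdl\<^bsub>L\<^esub> (mk_frac a \<one>) \<subseteq> PIdl\<^bsub>L\<^esub> (mk_frac b \<one>)" for a b
    proof -
      have "mk_frac a \<one> \<in> PIdl\<^bsub>L\<^esub> (mk_frac b \<one>)"
        using sub L.cgenideal_self[of "mk_frac a \<one>"] a one_S frac_closed by blast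
      then obtain r s where rs: "r \<in> carrier R" "s \<in> S" and eq: "mk_frac a \<one> = mk_frac r s \<otimes>\<^bsub>L\<^esub> mk_frac b \<one>"
        unfolding cgenideal_def carrier_L by blast
      note sc = S_c[OF rs(2)]
      have "mk_frac a \<one> = mk_frac (r \<otimes> b) s" using eq rs b one_S sc by (simp add: mult_L)
      then obtain t where t: "t \<in> S" "t \<otimes> (s \<otimes> a) = t \<otimes> (\<one> \<otimes> (r \<otimes> b))"
        using frac_eq_iff[OF a one_S _ rs(2), of "r \<otimes> b"] rs b by auto
      note tc = S_c[OF t(1)]
      have "(t \<otimes> s) \<otimes> a = t \<otimes> (s \<otimes> a)" using tc sc a by (simp add: m_assoc)
      also have "\<dots> = t \<otimes> (\<one> \<otimes> (r \<otimes> b))" by (rule t(2))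
      also have "\<dots> = (t \<otimes> r) \<otimes> b" using tc rs b by (simp add: m_assoc)
      finally show ?thesis using mult_S[OF t(1) rs(2)] tc rs(1) unfolding cgenideal_def by blast
    qed
    show "\<exists>t\<in>S. t \<otimes> x \<in> PIdl y \<or> t \<otimes> y \<in> PIdl x"
      using chained L.cgenideal_ideal[OF L(1)] L.cgenideal_ideal[OF L(2)] *[OF x y] *[OF y x]
      unfolding chained_ring_def by blast
  qed
next
  interpret L: cring L by (rule cring_L)
  assume cmp: "\<forall>x\<in>carrier R. \<forall>y\<in>carrier R. \<exists>t\<in>S. t \<otimes> x \<in> PIdl y \<or> t \<otimes> y \<in> PIdl x"
  \<comment> \<open>From t x = r y one reads off x / s = (s' r / (t s)) (y / s').\<close>
  have mult: "\<exists>g\<in>carrier L. mk_frac x s = g \<otimes>\<^bsub>L\<^esub> mk_frac y s'"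
    if c: "x \<in> carrier R" "s \<in> S" "y \<in> carrier R" "s' \<in> S" "t \<in> S" and t: "t \<otimes> x \<in> PIdl y" for x y s s' t
  proof -
    note sc = S_c[OF c(2)] S_c[OF c(4)] S_c[OF c(5)]
    obtain r where r: "r \<in> carrier R" and eq: "t \<otimes> x = r \<otimes> y" using t unfolding cgenideal_def by blast
    have "(t \<otimes> s \<otimes> s') \<otimes> x = (s' \<otimes> s) \<otimes> (t \<otimes> x)" using sc c(1) by algebra
    also have "\<dots> = (s' \<otimes> s) \<otimes> (r \<otimes> y)" by (simp only: eq)
    also have "\<dots> = s \<otimes> (s' \<otimes> r \<otimes> y)" using sc c(3) r by algebra
    finally have "mk_frac x s = mk_frac (s' \<otimes> r \<otimes> y) (t \<otimes> s \<otimes> s')"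
      using sc c r mult_S by (intro frac_eqI) auto
    also have "\<dots> = mk_frac (s' \<otimes> r) (t \<otimes> s) \<otimes>\<^bsub>L\<^esub> mk_frac y s'"
      using sc c r mult_S by (simp add: mult_L)
    finally show ?thesis using frac_closed[OF m_closed[OF sc(2) r] mult_S[OF c(5,2)]] by blast
  qed
  show "chained_ring L"
    unfolding chained_ring_def
  proof (intro conjI allI impI)
    fix I J assume I: "ideal I L" and J: "ideal J L"
    show "I \<subseteq> J \<or> J \<subseteq> I"
    proof (rule disjCI)
      assume "\<not> J \<subseteq> I"
      then obtain \<beta> where \<beta>: "\<beta> \<in> J" "\<beta> \<notin> I" by blast
      obtain y s' where y: "y \<in> carrier R" "s' \<in> S" "\<beta> = mk_frac y s'"
        using ideal.Icarr[OF J \<beta>(1)] unfolding carrier_L by blast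
      show "I \<subseteq> J"
      proof
        fix \<alpha> assume \<alpha>: "\<alpha> \<in> I"
        obtain x s where x: "x \<in> carrier R" "s \<in> S" "\<alpha> = mk_frac x s"
          using ideal.Icarr[OF I \<alpha>] unfolding carrier_L by blast
        have "\<not> (\<exists>g\<in>carrier L. \<beta> = g \<otimes>\<^bsub>L\<^esub> \<alpha>)" using ideal.I_l_closed[OF I \<alpha>] \<beta>(2) by blast
        then have "\<exists>g\<in>carrier L. \<alpha> = g \<otimes>\<^bsub>L\<^esub> \<beta>"
          using cmp x(1) y(1) mult[OF x(1,2) y(1,2)] mult[OF y(1,2) x(1,2)] unfolding x(3) y(3) by blast
        then show "\<alpha> \<in> J" using ideal.I_l_closed[OF J \<beta>(1)] by blast
      qed
    qed
  qed (rule cring_L)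
qed

end

section \<open>Arithmetical rings and ZPI-rings\<close>

lemma (in primeideal) mult_subset_complement: "mult_subset R (carrier R - I)"
  using one_imp_carrier I_notcarr I_prime by unfold_locales auto

context cring begin

lemma ex_maximalideal_above:
  assumes I: "ideal I R" and "I \<noteq> carrier R"
  shows "\<exists>M. maximalideal M R \<and> I \<subseteq> M"
proof -
  \<comment> \<open>Properness is expressed by the absence of 1, which passes to unions of
    chains.\<close>
  define \<A> where "\<A> = {J. ideal J R \<and> I \<subseteq> J \<and> \<one> \<notin> J}"
  have "I \<in> \<A>" using assms ideal.one_imp_carrier[OF I] by (auto simp: \<A>_def)
  moreover have "\<Union>\<C> \<in> \<A>" if C: "\<C> \<noteq> {}" "subset.chain \<A> \<C>" for \<C>
  proof -
    have "subset.chain {J. ideal J R} \<C>" using C(2) by (auto simp: pred_on.chain_def \<A>_def)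
    then have "ideal (\<Union>\<C>) R" using chain_Union_is_ideal[of \<C>] C(1) by simp
    then show ?thesis using C by (auto simp: pred_on.chain_def \<A>_def)
  qed
  ultimately obtain M where M: "M \<in> \<A>" and max: "\<And>J. J \<in> \<A> \<Longrightarrow> M \<subseteq> J \<Longrightarrow> J = M"
    using subset_Zorn_nonempty[of \<A>] by blast
  have "maximalideal M R"
  proof (rule maximalidealI)
    show "ideal M R" "carrier R \<noteq> M" using M by (auto simp: \<A>_def)
    show "J = M \<or> J = carrier R" if J: "ideal J R" "M \<subseteq> J" for J
      using max[of J] ideal.one_imp_carrier[OF J(1)] J M by (auto simp: \<A>_def)
  qed
  then show ?thesis using M by (auto simp: \<A>_def)
qed

text \<open>The colon ideals A and B have no common maximal ideal M above them: comparing x and y in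
  the localization at M yields an element of A or B outside M. Splitting 1 along A + B gives s and 1
  - s.\<close>

lemma arithmetical_imp_pruefer:
  assumes "arithmetical_ring R"
  shows "pruefer_cring R"
proof unfold_locales
  fix x y assume x: "x \<in> carrier R" and y: "y \<in> carrier R"
  define A where "A = {s \<in> carrier R. x \<otimes> s \<in> PIdl y}"
  define B where "B = {s \<in> carrier R. y \<otimes> s \<in> PIdl x}"
  have A: "ideal A R" and B: "ideal B R"
    unfolding A_def B_def by (intro ideal.helper_max_prime cgenideal_ideal is_cring x y)+
  have sub: "A \<subseteq> A <+>\<^bsub>R\<^esub> B" "B \<subseteq> A <+>\<^bsub>R\<^esub> B"
    using genideal_self[of "A \<union> B"] union_genideal[OF A B] ideal.Icarr[OF A] ideal.Icarr[OF B] by blast+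
  have "A <+>\<^bsub>R\<^esub> B = carrier R"
  proof (rule ccontr)
    assume "A <+>\<^bsub>R\<^esub> B \<noteq> carrier R"
    then obtain M where M: "maximalideal M R" "A <+>\<^bsub>R\<^esub> B \<subseteq> M"
      using ex_maximalideal_above[OF add_ideals[OF A B]] by blast
    interpret S: mult_subset R "carrier R - M"
      by (rule primeideal.mult_subset_complement[OF maximalideal_prime[OF M(1)]])
    have "chained_ring (localization_ring R (carrier R - M))"
      using assms M(1) by (simp add: arithmetical_ring_def)
    then obtain t where t: "t \<in> carrier R - M" "t \<otimes> x \<in> PIdl y \<or> t \<otimes> y \<in> PIdl x"
      using S.chained_L_iff x y by blast
    then have "t \<in> A \<or> t \<in> B" using m_comm x y by (auto simp: A_def B_def)
    then show False using t(1) sub M(2) by blast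
  qed
  then obtain s s' where s: "s \<in> A" and s': "s' \<in> B" and one: "\<one> = s \<oplus> s'"
    using one_closed unfolding set_add_def' by blast
  note sc = ideal.Icarr[OF A s] ideal.Icarr[OF B s']
  have "\<one> \<ominus> s = s'" unfolding one using sc by algebra
  moreover have "s \<otimes> x \<in> PIdl y" "s' \<otimes> y \<in> PIdl x"
    using s s' sc x y m_comm by (auto simp: A_def B_def)
  ultimately show "\<exists>s\<in>carrier R. \<exists>u\<in>carrier R. \<exists>v\<in>carrier R. s \<otimes> x = u \<otimes> y \<and> (\<one> \<ominus> s) \<otimes> y = v \<otimes> x"
    using sc(1) unfolding PIdl_iff by blast
qed

lemma arithmetical_TA_ideal:
  assumes "arithmetical_ring R" "TA_ideal I R" "I \<noteq> carrier R"
  shows "primeideal I R \<or> (\<exists>P Q. primeideal P R \<and> primeideal Q R \<and> I = ideal_prod R P Q)"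
proof -
  interpret P: pruefer_cring R by (rule arithmetical_imp_pruefer[OF assms(1)])
  interpret I: ideal I R using assms(2) by (simp add: TA_ideal_def)
  interpret pruefer_TA I R
    using assms(2,3) I.one_imp_carrier by unfold_locales (auto simp: TA_ideal_def)
  show ?thesis by (rule prime_or_product_of_two_primes)
qed

text \<open>Nonemptiness is carried as an implication so that the induction can start from the empty
  product.\<close>

lemma prime_factors_of_TA_factors:
  assumes R: "arithmetical_ring R"
    and "\<And>J. J \<in> set Js \<Longrightarrow> TA_ideal J R \<and> J \<noteq> carrier R"
  shows "\<exists>Ps. (Js \<noteq> [] \<longrightarrow> Ps \<noteq> []) \<and> (\<forall>P\<in>set Ps. primeideal P R) \<and>
           ideal_prod_list R Js = ideal_prod_list R Ps"
  using assms(2)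
proof (induction Js)
  case Nil
  show ?case by (intro exI[of _ "[]"]) simp
next
  case (Cons J Js)
  then obtain Ps where Ps: "\<forall>P\<in>set Ps. primeideal P R" "ideal_prod_list R Js = ideal_prod_list R Ps"
    by auto
  have i: "\<And>P. P \<in> set Ps \<Longrightarrow> ideal P R" using Ps(1) by (auto dest: primeideal.axioms(1))
  consider "primeideal J R" | P Q where "primeideal P R" "primeideal Q R" "J = ideal_prod R P Q"
    using arithmetical_TA_ideal[OF R, of J] Cons.prems[of J] by auto
  then show ?case
  proof cases
    case 1
    then show ?thesis using Ps by (intro exI[of _ "J # Ps"]) auto
  next
    case 2
    then have "ideal_prod_list R (J # Js) = ideal_prod_list R (P # Q # Ps)"
      using Ps(2) ideal_prod_assoc[OF primeideal.axioms(1)[OF 2(1)] primeideal.axioms(1)[OF 2(2)]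
          ideal_prod_list_ideal[of Ps, OF i]] by simp
    then show ?thesis using Ps(1) 2 by (intro exI[of _ "P # Q # Ps"]) auto
  qed
qed

lemma primeideal_imp_TA_ideal:
  assumes "primeideal P R"
  shows "TA_ideal P R"
proof -
  interpret P: primeideal P R by fact
  show ?thesis
    unfolding TA_ideal_def
  proof (intro conjI ballI impI)
    fix a b c assume "a \<in> carrier R" "b \<in> carrier R" "c \<in> carrier R" "a \<otimes> b \<otimes> c \<in> P"
    then show "a \<otimes> b \<in> P \<or> a \<otimes> c \<in> P \<or> b \<otimes> c \<in> P"
      using P.I_prime[of "a \<otimes> b" c] P.I_l_closed[of c a] by auto
  qed (rule P.is_ideal)
qed

lemma ZPI_imp_arithmetical:
  assumes "ZPI_ring R"
  shows "arithmetical_ring R"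
  unfolding arithmetical_ring_def
proof (intro conjI allI impI)
  fix M assume "maximalideal M R"
  then interpret M: primeideal M R by (rule maximalideal_prime)
  interpret ZPI_at_prime M R
    using assms unfolding ZPI_ring_def by unfold_locales blast
  interpret S: mult_subset R "carrier R - M" by (rule M.mult_subset_complement)
  show "chained_ring (localization_ring R (carrier R - M))"
    unfolding S.chained_L_iff using locally_comparable by blast
qed (rule is_cring)

end

theorem proposition2p9:
  fixes R :: "('a, 'b) ring_scheme" (structure)
  assumes "cring R"
  shows "(arithmetical_ring R \<longrightarrow>
            (\<forall>I. TA_ideal I R \<and> I \<noteq> carrier R \<longrightarrow>
               primeideal I R \<or>
               (\<exists>P Q. primeideal P R \<and> primeideal Q R \<and> I = ideal_prod R P Q)))
       \<and> (arithmetical_ring R \<and> TAF_ring R \<longleftrightarrow> ZPI_ring R)"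
proof -
  interpret cring R by fact
  have "ZPI_ring R" if ar: "arithmetical_ring R" and taf: "TAF_ring R"
    unfolding ZPI_ring_def
  proof (intro conjI allI impI)
    fix I assume "ideal I R" "I \<noteq> carrier R"
    then obtain Js where Js: "Js \<noteq> []" "\<And>J. J \<in> set Js \<Longrightarrow> TA_ideal J R \<and> J \<noteq> carrier R"
      and I: "I = ideal_prod_list R Js"
      using taf unfolding TAF_ring_def has_TA_factorization_def by blast
    show "\<exists>Ps. Ps \<noteq> [] \<and> (\<forall>P\<in>set Ps. primeideal P R) \<and> I = ideal_prod_list R Ps"
      using prime_factors_of_TA_factors[of Js, OF ar Js(2)] Js(1) I by auto
  qed (rule is_cring)
  \<comment> \<open>Primes are proper TA-ideals, so the prime factorization itself serves.\<close>
  moreover have "TAF_ring R" if "ZPI_ring R"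
    using that primeideal_imp_TA_ideal primeideal.I_notcarr
    unfolding ZPI_ring_def TAF_ring_def has_TA_factorization_def by metis
  ultimately show ?thesis using arithmetical_TA_ideal ZPI_imp_arithmetical by blast
qed

end
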